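(* Let $n\ge 2$ and let $\lambda=[\lambda_1,\ldots,\lambda_k]$ be a partition with $1\le k\le n-1$. Set $\lambda_i=0$ for $i>k$. Then the number of facets of $P(\lambda,n)$ is \[3n\lambda_1-n-3(\lambda_1-1)-(n-2)(\lambda_1-\lambda_2+\lambda_{n-1})-(k-a_{\lambda_1})-2(\lambda_1-D(\lambda))-C(\lambda),\] where $a_{\lambda_1}$ is the number of parts of $\lambda$ equal to $\lambda_1$, $D(\lambda)$ is the number of distinct part sizes of $\lambda$, and $C(\lambda)=2$ if $k=1$; $C(\lambda)=1$ if $1<k<n-1$ and $\lambda_1\neq\lambda_2$; $C(\lambda)=0$ if $1<k<n-1$ and $\lambda_1=\lambda_2$; $C(\lambda)=2$ if $k=n-1$ and either $\lambda_1\ne\lambda_2$ or all parts of $\lambda$ equal $\lambda_1$; $C(\lambda)=1$ if $k=n-1$, $\lambda_1=\lambda_2$, and not all parts of $\lambda$ equal $\lambda_1$.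
   Context: A partition $\lambda=[\lambda_1,\ldots,\lambda_k]$ is a weakly decreasing sequence of positive integers, of length $k$; $a_i$ is the number of parts equal to $i$. A sign matrix is a matrix with entries in $\{-1,0,1\}$ whose column partial sums from the top lie in $\{0,1\}$ and whose row partial sums from the left are nonnegative. $M(\lambda,n)$ is the set of $\lambda_1\times n$ sign matrices whose $i$-th row sums to $a_{\lambda_1-i+1}$ for each $1\le i\le\lambda_1$; $P(\lambda,n)$ is its convex hull in $\mathbb{R}^{\lambda_1 n}$. *)

theory Defs
  imports "HOL-Analysis.Analysis"
begin

definition is_partition :: "nat list \<Rightarrow> bool" where
  "is_partition lam \<longleftrightarrow> sorted_wrt (\<ge>) lam \<and> 0 \<notin> set lam"

text \<open>Parts are numbered from 1, and \<open>nth_part lam i = 0\<close> when \<open>i\<close> exceeds the length.\<close>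

definition nth_part :: "nat list \<Rightarrow> nat \<Rightarrow> nat" where
  "nth_part lam i = (if 1 \<le> i \<and> i \<le> length lam then lam ! (i - 1) else 0)"

definition part_count :: "nat list \<Rightarrow> nat \<Rightarrow> nat" where
  "part_count lam i = count_list lam i"

definition distinct_parts :: "nat list \<Rightarrow> nat" where
  "distinct_parts lam = card (set lam)"

text \<open>
  An \<open>m \<times> n\<close> matrix is an element of \<open>real^'c^'r\<close>, where \<open>'r\<close> and \<open>'c\<close> are finite linearly
  ordered types with \<open>m\<close> and \<open>n\<close> elements; such a type is order isomorphic to \<open>{1..m}\<close>
  (resp. \<open>{1..n}\<close>), and \<open>pos i\<close> is the number of the row or column \<open>i\<close>, counted from 1.
\<close>

definition pos :: "'a::{finite,linorder} \<Rightarrow> nat" where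
  "pos i = card {..i}"

definition sign_matrix :: "real^'c::{finite,linorder}^'r::{finite,linorder} \<Rightarrow> bool" where
  "sign_matrix A \<longleftrightarrow>
     (\<forall>i j. A $ i $ j \<in> {-1, 0, 1}) \<and>
     (\<forall>i j. (\<Sum>i'\<in>{..i}. A $ i' $ j) \<in> {0, 1}) \<and>
     (\<forall>i j. (\<Sum>j'\<in>{..j}. A $ i $ j') \<ge> 0)"

text \<open>
  The sets \<open>M(\<lambda>,n)\<close> and \<open>P(\<lambda>,n)\<close>. They have their intended meaning when \<open>CARD('r)\<close> is the
  largest part \<open>\<lambda>\<^sub>1\<close> and \<open>CARD('c)\<close> is \<open>n\<close>; then \<open>1 \<le> pos i \<le> \<lambda>\<^sub>1\<close>, so the subtraction
  below does not truncate.
\<close>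

definition sign_matrices :: "nat list \<Rightarrow> (real^'c::{finite,linorder}^'r::{finite,linorder}) set" where
  "sign_matrices lam =
     {A. sign_matrix A \<and>
         (\<forall>i. (\<Sum>j\<in>UNIV. A $ i $ j) = real (part_count lam (nth_part lam 1 - pos i + 1)))}"

definition sign_polytope :: "nat list \<Rightarrow> (real^'c::{finite,linorder}^'r::{finite,linorder}) set" where
  "sign_polytope lam = convex hull (sign_matrices lam)"

definition facet_corr :: "nat list \<Rightarrow> nat \<Rightarrow> int" where
  "facet_corr lam n =
     (if length lam = 1 then 2
      else if length lam < n - 1 then (if nth_part lam 1 \<noteq> nth_part lam 2 then 1 else 0)
      else (if nth_part lam 1 \<noteq> nth_part lam 2 \<or> (\<forall>x\<in>set lam. x = nth_part lam 1) then 2 else 1))"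

end

theory Submission
  imports Defs
begin

text \<open>
  Write \<open>H(i,j)\<close> for the sum of the entries in the first \<open>i\<close> rows and \<open>j\<close> columns. In these
  coordinates the conditions on a sign matrix become
  \<open>0 \<le> H(i,j) - H(i,j-1) \<le> 1\<close> and \<open>H(i-1,j) \<le> H(i,j)\<close>, with prescribed boundary values
  \<open>H(i,n) = S\<^sub>i\<close>, where \<open>S\<^sub>i\<close> is the number of parts of size at least \<open>\<lambda>\<^sub>1 - i + 1\<close>. These are
  difference constraints with integer right-hand sides, so every extreme point of the polytope they
  define is integral, and the polytope is \<open>P(\<lambda>,n)\<close>. It is full-dimensional in the affine space given
  by the boundary values; hence its facets correspond to the inequalities of an irredundant
  subsystem. Such a subsystem is found by discarding the inequalities that follow from others, and
  each remaining one is shown to be needed by an integral \<open>H\<close> that violates it alone.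
\<close>

section \<open>Facets of a polyhedron given by an irredundant system\<close>

text \<open>For fixed i the differences H(i,j) - H(i,j-1) are n numbers in [0,1] with sum S_i, and 1
  \<le> S_i \<le> n-1 because 1 \<le> k \<le> n-1. If S_i = 1, their nonnegativity implies the upper
  bounds; if S_i = n-1, the upper bounds imply nonnegativity. So for n > 2 a lower bound survives
  only when S_i < n-1 and an upper bound only when 1 < S_i. In column n, H(i,n) is fixed and
  H(i,n-1) grows with i; among rows of equal sum only the last lower bound and the first upper bound
  matter, and this is where D(\<lambda>) enters. A monotonicity constraint between rows i-1 and i is
  implied as soon as the jump S_i - S_(i-1) is at least n-j, the number of columns that remain.
  Replacing H(i,j) by j - H(i,j) and S_i by n - S_i, and reversing the order of the rows, exchanges
  lower and upper bounds. Hence the arguments come in pairs, and row 1 plays for one kind the part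
  that row m plays for the other.\<close>

lemma card_facets_irredundant_system:
  fixes V :: "'a::euclidean_space set" and f :: "'k \<Rightarrow> 'a \<Rightarrow> real"
  assumes "affine V" and "finite K"
    and lin: "\<And>k. k \<in> K \<Longrightarrow> linear (f k)"
    and pV: "p \<in> V" and p: "\<And>k. k \<in> K \<Longrightarrow> f k p < b k"
    and qV: "\<And>k. k \<in> K \<Longrightarrow> q k \<in> V"
    and q_viol: "\<And>k. k \<in> K \<Longrightarrow> b k < f k (q k)"
    and q_sat: "\<And>k l. k \<in> K \<Longrightarrow> l \<in> K \<Longrightarrow> l \<noteq> k \<Longrightarrow> f l (q k) \<le> b l"
    and S: "S = {x \<in> V. \<forall>k\<in>K. f k x \<le> b k}"
  shows "card {F. F facet_of S} = card K"
proof -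
  define a where "a = (\<lambda>k. \<Sum>i\<in>Basis. f k i *\<^sub>R i)"
  have a: "f k x = a k \<bullet> x" if "k \<in> K" for k x
  proof -
    interpret linear "f k" by (rule lin[OF that])
    have "f k x = f k (\<Sum>i\<in>Basis. (x \<bullet> i) *\<^sub>R i)" by (simp add: euclidean_representation)
    also have "\<dots> = (\<Sum>i\<in>Basis. (x \<bullet> i) * f k i)" by (simp add: sum scale)
    also have "\<dots> = a k \<bullet> x" by (simp add: a_def inner_sum_left inner_commute[of x] mult.commute)
    finally show ?thesis .
  qed
  define h where "h = (\<lambda>k. {x. a k \<bullet> x \<le> b k})"
  have q_in: "q k \<in> h l \<longleftrightarrow> l \<noteq> k" if "k \<in> K" "l \<in> K" for k l
    using q_sat[OF that] q_viol[OF that(1)] a[OF that(2)] a[OF that(1)] that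
    by (auto simp: h_def not_le)
  have inj: "inj_on h K"
    by (rule inj_onI) (metis q_in)
  have S': "S = V \<inter> \<Inter>(h ` K)"
    by (auto simp: S h_def a)
  \<comment> \<open>The point \<open>p\<close> lies in \<open>V \<inter> T\<close>, a relatively
    open part of \<open>V\<close> inside \<open>S\<close>; a nonempty relatively open part of an
    affine set spans it.\<close>
  have hull: "affine hull S = V"
  proof -
    define T where "T = (\<Inter>k\<in>K. {x. a k \<bullet> x < b k})"
    have "open T" unfolding T_def using \<open>finite K\<close> by (intro open_INT ballI open_halfspace_lt) auto
    moreover have "p \<in> V \<inter> T" using pV p by (auto simp: T_def a)
    ultimately have "affine hull (V \<inter> T) = V"
      using affine_hull_affine_Int_open[OF \<open>affine V\<close>, of T] \<open>affine V\<close>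
      by (metis affine_hull_eq empty_iff)
    moreover have "V \<inter> T \<subseteq> S" "S \<subseteq> V" by (auto simp: S' T_def h_def less_imp_le)
    ultimately show ?thesis
      by (metis \<open>affine V\<close> hull_minimal hull_mono subset_antisym)
  qed
  \<comment> \<open>The description of facets used below is indexed by half-spaces, not by
    \<open>K\<close>. The points \<open>q k\<close> separate the half-spaces, so the index can be
    recovered.\<close>
  define g where "g = inv_into K h"
  have g: "g (h k) = k" if "k \<in> K" for k
    by (simp add: g_def inj that)
  have facet: "C facet_of S \<longleftrightarrow> (\<exists>H. H \<in> h ` K \<and> C = S \<inter> {x. a (g H) \<bullet> x = b (g H)})" for C
  proof (rule facet_of_polyhedron_explicit)
    show "finite (h ` K)" using \<open>finite K\<close> by simp
    show "S = affine hull S \<inter> \<Inter>(h ` K)" unfolding hull by (rule S')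
    show "a (g H) \<noteq> 0 \<and> H = {x. a (g H) \<bullet> x \<le> b (g H)}" if "H \<in> h ` K" for H
    proof -
      from that obtain k where k: "k \<in> K" "H = h k" by auto
      \<comment> \<open>A zero normal would make \<open>f k\<close> vanish everywhere, against
        \<open>f k p < b k < f k (q k)\<close>.\<close>
      have "a k \<noteq> 0" using p[OF k(1)] q_viol[OF k(1)] by (auto simp: a[OF k(1)])
      then show ?thesis by (simp add: k g) (simp add: h_def)
    qed
    show "S \<subset> affine hull S \<inter> \<Inter>F'" if "F' \<subset> h ` K" for F'
    proof -
      from that obtain k where k: "k \<in> K" "h k \<notin> F'" by auto
      have "q k \<in> H" if "H \<in> F'" for H
        using that \<open>F' \<subset> h ` K\<close> k q_in[OF k(1)] by blast
      then have "q k \<in> V \<inter> \<Inter>F'" using qV[OF k(1)] by auto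
      moreover have "q k \<notin> S" using q_in[OF k(1) k(1)] k(1) by (auto simp: S')
      moreover have "S \<subseteq> V \<inter> \<Inter>F'" using that by (auto simp: S')
      ultimately show ?thesis by (auto simp: hull)
    qed
  qed
  have facet_eq: "{F. F facet_of S} = (\<lambda>k. S \<inter> {x. f k x = b k}) ` K"
    by (auto simp: facet g a)
  \<comment> \<open>Each facet contains a point at which all other inequalities are strict, so
    distinct indices give distinct facets.\<close>
  have "inj_on (\<lambda>k. S \<inter> {x. f k x = b k}) K"
  proof (rule inj_onI, rule ccontr)
    fix k l assume k: "k \<in> K" and l: "l \<in> K" and "k \<noteq> l"
      and eq: "S \<inter> {x. f k x = b k} = S \<inter> {x. f l x = b l}"
    \<comment> \<open>the point where the segment from \<open>p\<close> to \<open>q k\<close> leaves the half-space of \<open>k\<close>\<close>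
    define t where "t = (b k - f k p) / (f k (q k) - f k p)"
    have t: "0 < t" "t < 1" using p[OF k] q_viol[OF k] by (auto simp: t_def field_simps)
    define z where "z = (1 - t) *\<^sub>R p + t *\<^sub>R q k"
    have fz: "f i z = (1 - t) * f i p + t * f i (q k)" if "i \<in> K" for i
      by (simp add: a[OF that] z_def inner_add_right)
    have "z \<in> V" using \<open>affine V\<close> pV qV[OF k] unfolding affine_def z_def by simp
    have zk: "f k z = b k"
    proof -
      have "t * (f k (q k) - f k p) = b k - f k p"
        using p[OF k] q_viol[OF k] by (simp add: t_def)
      then show ?thesis by (simp add: fz[OF k] algebra_simps)
    qed
    have zi: "f i z < b i" if "i \<in> K" "i \<noteq> k" for i
    proof -
      have "(1 - t) * f i p < (1 - t) * b i" using t p[OF that(1)] by simp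
      moreover have "t * f i (q k) \<le> t * b i" using t q_sat[OF k that] by simp
      ultimately show ?thesis by (simp add: fz[OF that(1)] algebra_simps)
    qed
    have "z \<in> S" using \<open>z \<in> V\<close> zk zi by (force simp: S)
    then have "f l z = b l" using eq zk by blast
    then show False using zi[OF l] \<open>k \<noteq> l\<close> by simp
  qed
  then show ?thesis by (simp add: facet_eq card_image)
qed

section \<open>The inequalities on corner sums\<close>

datatype ineq = Lower nat nat | Upper nat nat | Mono nat nat

text \<open>Polymorphic because the same inequalities are evaluated at integer witnesses and at real
  corner sums.\<close>

fun form :: "ineq \<Rightarrow> (nat \<Rightarrow> nat \<Rightarrow> 'a::linordered_idom) \<Rightarrow> 'a" where
  "form (Lower i j) h = h i (j - 1) - h i j"
| "form (Upper i j) h = h i j - h i (j - 1)"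
| "form (Mono i j) h = h (i - 1) j - h i j"

fun bound :: "ineq \<Rightarrow> 'a::linordered_idom" where
  "bound (Upper i j) = 1"
| "bound _ = 0"

definition holds :: "(nat \<Rightarrow> nat \<Rightarrow> 'a::linordered_idom) \<Rightarrow> ineq \<Rightarrow> bool" where
  "holds h k \<longleftrightarrow> form k h \<le> bound k"

lemma holds_simps [simp]:
  "holds h (Lower i j) \<longleftrightarrow> h i (j - 1) \<le> h i j"
  "holds h (Upper i j) \<longleftrightarrow> h i j \<le> h i (j - 1) + 1"
  "holds h (Mono i j) \<longleftrightarrow> h (i - 1) j \<le> h i j"
  by (auto simp: holds_def algebra_simps)

locale row_sums =
  fixes m n :: nat and S :: "nat \<Rightarrow> nat"
  assumes m: "1 \<le> m" and n: "2 \<le> n" and S0: "S 0 = 0"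
    and S1: "1 \<le> S 1" and Sm: "S m < n"
    and S_step: "\<And>i. i < m \<Longrightarrow> S i \<le> S (Suc i)"
begin

definition boundary :: "(nat \<Rightarrow> nat \<Rightarrow> 'a::linordered_idom) \<Rightarrow> bool" where
  "boundary h \<longleftrightarrow> (\<forall>j\<le>n. h 0 j = 0) \<and> (\<forall>i\<le>m. h i 0 = 0 \<and> h i n = of_nat (S i))"

definition all_ineqs :: "ineq set" where
  "all_ineqs = {Lower i j |i j. i \<in> {1..m} \<and> j \<in> {1..n}}
     \<union> {Upper i j |i j. i \<in> {1..m} \<and> j \<in> {1..n}}
     \<union> {Mono i j |i j. i \<in> {1..m} \<and> j \<in> {1..n}}"

text \<open>
  The outer columns carry the exceptions: \<open>Lower i 1\<close> follows from \<open>Lower 1 1\<close> and \<open>Upper i 1\<close>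
  from \<open>Upper m 1\<close>, while \<open>Lower i n\<close> and \<open>Upper i n\<close> follow from an adjacent row with the same
  sum. If \<open>n = 2\<close>, then all \<open>S i\<close> are 1 and \<open>Lower i 1\<close>, \<open>Upper i 2\<close> are the same inequality, as
  are \<open>Upper i 1\<close>, \<open>Lower i 2\<close>; only one of each pair is kept.
\<close>

definition facet_ineqs :: "ineq set" where
  "facet_ineqs =
     {Lower i j |i j. i \<in> {1..m} \<and> j \<in> {1..n} \<and>
        (if j = 1 then i = 1 \<and> (S 1 < n - 1 \<or> n = 2)
         else S i < n - 1 \<and> (j = n \<longrightarrow> i = m \<or> S i < S (i + 1)))}
     \<union> {Upper i j |i j. i \<in> {1..m} \<and> j \<in> {1..n} \<and>
        (if j = 1 then i = m \<and> (1 < S m \<or> n = 2)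
         else 1 < S i \<and> (j = n \<longrightarrow> S (i - 1) < S i))}
     \<union> {Mono i j |i j. i \<in> {2..m} \<and> 1 \<le> j \<and> S i + j < n + S (i - 1)}"

section \<open>The kept inequalities imply all the others\<close>

lemma S_mono: "i \<le> i' \<Longrightarrow> i' \<le> m \<Longrightarrow> S i \<le> S i'"
proof (induction i' rule: dec_induct)
  case (step k)
  then show ?case using S_step[of k] by simp
qed simp

lemma S_bounds: "1 \<le> i \<Longrightarrow> i \<le> m \<Longrightarrow> 1 \<le> S i \<and> S i \<le> n - 1"
  using S_mono[of 1 i] S_mono[of i m] S1 Sm by simp

lemma facet_ineqs_subset: "facet_ineqs \<subseteq> all_ineqs"
proof -
  have "j \<le> n" if "i \<in> {2..m}" "S i + j < n + S (i - 1)" for i j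
    using S_mono[of "i - 1" i] that by simp
  then show ?thesis by (auto simp: facet_ineqs_def all_ineqs_def)
qed

text \<open>The outer columns come from monotonicity in columns 1 and n-1, which is available before
  \<open>Mono\<close> is known in general. With the middle columns they give every
  \<open>Lower\<close> and \<open>Upper\<close>; these bound each row between 0 and
  \<open>S i\<close>, and only then do the discarded \<open>Mono\<close> follow.\<close>

lemma facet_ineqs_suffice:
  fixes h :: "nat \<Rightarrow> nat \<Rightarrow> 'a::linordered_idom"
  assumes bd: "boundary h" and K: "\<And>k. k \<in> facet_ineqs \<Longrightarrow> holds h k" and "k \<in> all_ineqs"
  shows "holds h k"
proof -
  have h0: "h 0 j = 0" if "j \<le> n" for j using bd that by (simp add: boundary_def)
  have hi0: "h i 0 = 0" and hin: "h i n = of_nat (S i)" if "i \<le> m" for i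
    using bd that by (auto simp: boundary_def)
  have K1: "h i (j - 1) \<le> h i j" if "Lower i j \<in> facet_ineqs" for i j using K[OF that] by simp
  have K2: "h i j \<le> h i (j - 1) + 1" if "Upper i j \<in> facet_ineqs" for i j using K[OF that] by simp
  have K3: "h (i - 1) j \<le> h i j" if "i \<in> {2..m}" "1 \<le> j" "S i + j < n + S (i - 1)" for i j
    using K[of "Mono i j"] that by (simp add: facet_ineqs_def)
  have mid_low: "h i (j - 1) \<le> h i j" if "1 \<le> i" "i \<le> m" "2 \<le> j" "j < n" "S i < n - 1" for i j
    using that by (intro K1) (auto simp: facet_ineqs_def)
  have mid_up: "h i j \<le> h i (j - 1) + 1" if "1 \<le> i" "i \<le> m" "2 \<le> j" "j < n" "1 < S i" for i j
    using that by (intro K2) (auto simp: facet_ineqs_def)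
  have from_low: "h i j \<le> h i j'"
    if "j \<le> j'" "\<And>t. j < t \<Longrightarrow> t \<le> j' \<Longrightarrow> h i (t - 1) \<le> h i t" for i j j'
    using that
  proof (induction j' rule: dec_induct)
    case (step t)
    then show ?case using step.prems[of "Suc t"] step.IH by force
  qed simp
  have from_up: "h i j' \<le> h i j + of_nat (j' - j)"
    if "j \<le> j'" "\<And>t. j < t \<Longrightarrow> t \<le> j' \<Longrightarrow> h i t \<le> h i (t - 1) + 1" for i j j'
    using that
  proof (induction j' rule: dec_induct)
    case (step t)
    have "h i (Suc t) \<le> h i t + 1" using step.prems[of "Suc t"] step.hyps by simp
    moreover have "h i t \<le> h i j + of_nat (t - j)" using step.IH step.prems by simp
    ultimately show ?case using step.hyps by (simp add: Suc_diff_le)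
  qed simp
  have col: "h i j \<le> h i' j"
    if "i \<le> i'" "1 \<le> i" "i' \<le> m" "\<And>t. i < t \<Longrightarrow> t \<le> i' \<Longrightarrow> S t + j < n + S (t - 1)" "1 \<le> j" for i i' j
    using that
  proof (induction i' rule: dec_induct)
    case (step t)
    have "h t j \<le> h (Suc t) j" using K3[of "Suc t" j] step.hyps step.prems(1,2,4) step.prems(3)[of "Suc t"] by simp
    moreover have "h i j \<le> h t j" using step by simp
    ultimately show ?case by simp
  qed simp
  \<comment> \<open>\<open>Mono t 1\<close> is always kept, so column 1 is monotone and its bounds
    need to be known only in rows 1 and m.\<close>
  have step1: "S t + 1 < n + S (t - 1)" if "1 < t" "t \<le> m" for t
  proof -
    have "1 \<le> S (t - 1)" "S t \<le> n - 1" using S_bounds[of "t - 1"] S_bounds[of t] that by auto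
    then show ?thesis using n by linarith
  qed
  have last_step: "h i (n - 1) \<le> h (Suc i) (n - 1)" if "1 \<le> i" "i < m" "S (Suc i) = S i" for i
  proof -
    have "S (Suc i) + (n - 1) < n + S i" using that n by linarith
    then show ?thesis using K3[of "Suc i" "n - 1"] that n by simp
  qed
  have low1: "0 \<le> h i 1" if "1 \<le> i" "i \<le> m" for i
  proof -
    have "0 \<le> h 1 1"
    proof (cases "S 1 < n - 1 \<or> n = 2")
      case True
      then have "Lower 1 1 \<in> facet_ineqs" using m n by (auto simp: facet_ineqs_def)
      then show ?thesis using K1[of 1 1] hi0[of 1] m by simp
    next
      case False
      then have S1': "S 1 = n - 1" "3 \<le> n" using S_bounds[of 1] m n by auto
      \<comment> \<open>The n-1 increments after column 1 are at most 1 and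
        \<open>h 1 n = n - 1\<close>, which leaves \<open>h 1 1 \<ge> 0\<close>.\<close>
      have "h 1 n \<le> h 1 1 + of_nat (n - 1)"
      proof (rule from_up)
        fix t assume "1 < t" "t \<le> n"
        moreover have "h 1 n \<le> h 1 (n - 1) + 1"
          using S1' S0 m n by (intro K2) (auto simp: facet_ineqs_def)
        ultimately show "h 1 t \<le> h 1 (t - 1) + 1"
          using mid_up[of 1 t] S1' m by (cases "t = n") auto
      qed (use n in simp)
      then show ?thesis using hin[of 1] m S1' by simp
    qed
    also have "h 1 1 \<le> h i 1" using col[of 1 i 1] step1 that by simp
    finally show ?thesis .
  qed
  have up1: "h i 1 \<le> 1" if "1 \<le> i" "i \<le> m" for i
  proof -
    have "h i 1 \<le> h m 1" using col[of i m 1] step1 that by simp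
    also have "\<dots> \<le> 1"
    proof (cases "1 < S m \<or> n = 2")
      case True
      then have "Upper m 1 \<in> facet_ineqs" using m n by (auto simp: facet_ineqs_def)
      then show ?thesis using K2[of m 1] hi0[of m] m by simp
    next
      case False
      then have Sm': "S m = 1" "3 \<le> n" using S_bounds[of m] m n by auto
      have "h m 1 \<le> h m n"
      proof (rule from_low)
        fix t assume "1 < t" "t \<le> n"
        moreover have "h m (n - 1) \<le> h m n"
          using Sm' m n by (intro K1) (auto simp: facet_ineqs_def)
        ultimately show "h m (t - 1) \<le> h m t"
          using mid_low[of m t] Sm' m by (cases "t = n") auto
      qed (use n in simp)
      then show ?thesis using hin[of m] Sm' by simp
    qed
    finally show ?thesis .
  qed
  \<comment> \<open>Upward induction: where the sum does not change, the bound is inherited from the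
    row before by monotonicity in column n-1; where it jumps, \<open>Upper i n\<close> is kept or
    the sum is 1.\<close>
  have last_up: "of_nat (S i) \<le> h i (n - 1) + 1" if "1 \<le> i" "i \<le> m" for i
    using that
  proof (induction i rule: dec_induct)
    have *: "of_nat (S i) \<le> h i (n - 1) + 1" if "1 \<le> i" "i \<le> m" "S i = 1" for i
    proof -
      have "h i 1 \<le> h i (n - 1)"
      proof (rule from_low)
        fix t assume "1 < t" "t \<le> n - 1"
        then show "h i (t - 1) \<le> h i t" using mid_low[of i t] that by simp
      qed (use n in simp)
      then show ?thesis using low1[OF that(1,2)] that(3) by simp
    qed
    have **: "of_nat (S i) \<le> h i (n - 1) + 1" if "1 \<le> i" "i \<le> m" "1 < S i" "S (i - 1) < S i" for i
      using K2[of i n] hin[of i] that n by (auto simp: facet_ineqs_def)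
    {
      case base
      then show ?case using *[of 1] **[of 1] S1 S0 m by (cases "S 1 = 1") auto
    next
      case (step i)
      show ?case
      proof (cases "S (Suc i) = S i")
        case True
        then show ?thesis using last_step[of i] step by auto
      next
        case False
        then have "S i < S (Suc i)" using S_step[of i] step by simp
        then show ?thesis using *[of "Suc i"] **[of "Suc i"] step by (cases "S (Suc i) = 1") auto
      qed
    }
  qed
  \<comment> \<open>The dual statement, hence a downward induction: a row inherits the bound from
    the next row with the same sum.\<close>
  have last_low: "h i (n - 1) \<le> of_nat (S i)" if "1 \<le> i" "i \<le> m" for i
    using that(2,1)
  proof (induction i rule: inc_induct)
    have *: "h i (n - 1) \<le> of_nat (S i)" if "1 \<le> i" "i \<le> m" "S i = n - 1" for i
    proof -
      have "h i (n - 1) \<le> h i 1 + of_nat (n - 1 - 1)"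
      proof (rule from_up)
        fix t assume "1 < t" "t \<le> n - 1"
        then show "h i t \<le> h i (t - 1) + 1" using mid_up[of i t] that by simp
      qed (use n in simp)
      then have "h i (n - 1) \<le> 1 + of_nat (n - 1 - 1)" using up1[OF that(1,2)] by simp
      also have "\<dots> = of_nat (S i)" using that n by (metis One_nat_def Suc_diff_Suc Suc_1 Suc_le_lessD diff_Suc_1 of_nat_Suc zero_less_diff less_imp_le)
      finally show ?thesis .
    qed
    have **: "h i (n - 1) \<le> of_nat (S i)" if "1 \<le> i" "i \<le> m" "S i < n - 1" "i = m \<or> S i < S (i + 1)" for i
      using K1[of i n] hin[of i] that n by (auto simp: facet_ineqs_def)
    {
      case base
      then show ?case using *[of m] **[of m] S_bounds[of m] m by (cases "S m = n - 1") auto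
    next
      case (step i)
      show ?case
      proof (cases "S (Suc i) = S i")
        case True
        then show ?thesis using last_step[of i] step by auto
      next
        case False
        then have "S i < S (Suc i)" using S_step[of i] step by simp
        then show ?thesis using *[of i] **[of i] S_bounds[of i] step by (cases "S i = n - 1") auto
      qed
    }
  qed
  have low: "h i (j - 1) \<le> h i j" if ij: "1 \<le> i" "i \<le> m" "1 \<le> j" "j \<le> n" for i j
  proof -
    consider "j = 1" | "j = n" | "2 \<le> j" "j < n" "S i < n - 1" | "2 \<le> j" "j < n" "S i = n - 1"
      using ij S_bounds[of i] by linarith
    then show ?thesis
    proof cases
      \<comment> \<open>Here the upper bounds from both ends pin the row down:
        \<open>h i (j - 1) \<le> j - 1\<close>, and
        \<open>h i j \<ge> n - 1 - (n - j) = j - 1\<close>.\<close>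
      case 4
      have up: "h i t \<le> h i (t - 1) + 1" if "1 \<le> t" "t \<le> n" for t
      proof -
        have "1 < S i" using 4 by simp
        then show ?thesis
          using mid_up[of i t] up1[of i] last_up[of i] hin[of i] hi0[of i] \<open>1 \<le> i\<close> \<open>i \<le> m\<close> that
          by (cases "t = 1"; cases "t = n") auto
      qed
      have "h i (j - 1) \<le> h i 0 + of_nat (j - 1 - 0)" by (rule from_up) (use up 4 in auto)
      moreover have "h i n \<le> h i j + of_nat (n - j)" by (rule from_up) (use up 4 in auto)
      moreover have "of_nat (S i) = of_nat (j - 1) + (of_nat (n - j) :: 'a)"
        using 4 by (simp flip: of_nat_add)
      ultimately show ?thesis using hin[of i] hi0[of i] that by simp
    qed (use low1[of i] last_low[of i] hin[of i] hi0[of i] mid_low[of i j] that in auto)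
  qed
  have nonneg: "0 \<le> h i j" and le_S: "h i j \<le> of_nat (S i)" if "1 \<le> i" "i \<le> m" "j \<le> n" for i j
    using from_low[of 0 j i] from_low[of j n i] low[of i] that hin[of i] hi0[of i] by auto
  have up: "h i j \<le> h i (j - 1) + 1" if ij: "1 \<le> i" "i \<le> m" "1 \<le> j" "j \<le> n" for i j
  proof -
    consider "j = 1" | "j = n" | "2 \<le> j" "j < n" "1 < S i" | "2 \<le> j" "j < n" "S i = 1"
      using ij S_bounds[of i] by linarith
    then show ?thesis
    proof cases
      case 4
      have "h i j \<le> 1" "0 \<le> h i (j - 1)" using le_S[of i j] nonneg[of i "j - 1"] 4 ij by auto
      then show ?thesis by linarith
    qed (use up1[of i] last_up[of i] hin[of i] hi0[of i] mid_up[of i j] that in auto)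
  qed
  have mono: "h (i - 1) j \<le> h i j" if ij: "1 \<le> i" "i \<le> m" "1 \<le> j" "j \<le> n" for i j
  proof -
    consider "i = 1" | "2 \<le> i" "S i + j < n + S (i - 1)" | "2 \<le> i" "n + S (i - 1) \<le> S i + j"
      using ij by linarith
    then show ?thesis
    proof cases
      \<comment> \<open>The value \<open>S (i - 1)\<close> separates the rows: row
        \<open>i - 1\<close> never exceeds it, and row \<open>i\<close> has reached it at column
        \<open>j\<close>, since at most \<open>n - j\<close> can still be gained.\<close>
      case 3
      have "h (i - 1) j \<le> of_nat (S (i - 1))" using le_S[of "i - 1" j] 3 that by simp
      moreover have "h i n \<le> h i j + of_nat (n - j)" by (rule from_up) (use up that in auto)
      moreover have "S (i - 1) + (n - j) \<le> S i" using 3 ij by linarith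
      then have "of_nat (S (i - 1)) + of_nat (n - j) \<le> (of_nat (S i) :: 'a)"
        by (metis of_nat_add of_nat_le_iff)
      ultimately show ?thesis using hin[of i] that by simp
    qed (use h0[of j] nonneg[of i j] K3[of i j] that in auto)
  qed
  show ?thesis using assms(3) low up mono by (auto simp: all_ineqs_def)
qed

section \<open>Each kept inequality is needed\<close>

text \<open>
  Among the prefix sums of 0-1 rows with sum \<open>s\<close>, \<open>left_row s\<close> is the largest and \<open>right_row s\<close> the
  smallest. Using them above and below a given block of rows makes the inequalities between rows
  outside the block automatic.
\<close>

definition left_row :: "nat \<Rightarrow> nat \<Rightarrow> int" where
  "left_row s j = min (int j) (int s)"

definition right_row :: "nat \<Rightarrow> nat \<Rightarrow> int" where
  "right_row s j = max 0 (int j + int s - int n)"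

definition stack :: "nat \<Rightarrow> nat \<Rightarrow> (nat \<Rightarrow> nat \<Rightarrow> int) \<Rightarrow> nat \<Rightarrow> nat \<Rightarrow> int" where
  "stack lo hi mid i = (if i < lo then right_row (S i) else if i \<le> hi then mid i else left_row (S i))"

text \<open>Only the rows of the block \<open>lo..hi\<close> and its two interfaces have to be
  checked. At the interfaces all columns are compared with an extreme row, so the side conditions on
  kept \<open>Mono\<close> are not consulted there.\<close>

lemma stack_witness:
  assumes range: "1 \<le> lo" "lo \<le> hi" "hi \<le> m"
    and mid: "\<And>i. lo \<le> i \<Longrightarrow> i \<le> hi \<Longrightarrow> mid i 0 = 0 \<and> mid i n = int (S i)"
    and below: "\<And>j. 1 < lo \<Longrightarrow> j \<le> n \<Longrightarrow> right_row (S (lo - 1)) j \<le> mid lo j"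
    and above: "\<And>j. hi < m \<Longrightarrow> j \<le> n \<Longrightarrow> mid hi j \<le> left_row (S (hi + 1)) j"
    and low: "\<And>i j. lo \<le> i \<Longrightarrow> i \<le> hi \<Longrightarrow> Lower i j \<in> facet_ineqs - {k} \<Longrightarrow> mid i (j - 1) \<le> mid i j"
    and up: "\<And>i j. lo \<le> i \<Longrightarrow> i \<le> hi \<Longrightarrow> Upper i j \<in> facet_ineqs - {k} \<Longrightarrow> mid i j \<le> mid i (j - 1) + 1"
    and mono: "\<And>i j. lo < i \<Longrightarrow> i \<le> hi \<Longrightarrow> Mono i j \<in> facet_ineqs - {k} \<Longrightarrow> mid (i - 1) j \<le> mid i j"
    and viol: "\<not> holds (stack lo hi mid) k"
  shows "\<exists>h :: nat \<Rightarrow> nat \<Rightarrow> int. boundary h \<and> \<not> holds h k \<and> (\<forall>l \<in> facet_ineqs - {k}. holds h l)"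
proof (intro exI conjI ballI)
  let ?h = "stack lo hi mid"
  \<comment> \<open>This makes \<open>right_row (S i)\<close> start at 0; \<open>S 0 = 0\<close>
    makes row 0 the zero row.\<close>
  have "S i < n" if "i \<le> m" for i using S_mono[OF that] Sm by simp
  then show "boundary ?h"
    using range mid unfolding boundary_def
    by (auto simp: stack_def left_row_def right_row_def S0)
  show "\<not> holds ?h k" by (rule viol)
  fix l assume l: "l \<in> facet_ineqs - {k}"
  show "holds ?h l"
  proof (cases l)
    case (Lower i j)
    then have "1 \<le> i" "i \<le> m" "1 \<le> j" using l by (auto simp: facet_ineqs_def)
    then show ?thesis using low[of i j] l unfolding Lower
      by (auto simp: stack_def left_row_def right_row_def)
  next
    case (Upper i j)
    then have "1 \<le> i" "i \<le> m" "1 \<le> j" using l by (auto simp: facet_ineqs_def)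
    then show ?thesis using up[of i j] l unfolding Upper
      by (auto simp: stack_def left_row_def right_row_def)
  next
    case (Mono i j)
    then have i: "2 \<le> i" "i \<le> m" "1 \<le> j" and "S i + j < n + S (i - 1)" using l by (auto simp: facet_ineqs_def)
    moreover have Si: "S (i - 1) \<le> S i" using S_mono[of "i - 1" i] i by simp
    ultimately have j: "j \<le> n" by linarith
    consider "i < lo" | "i = lo" | "lo < i" "i \<le> hi" | "i = hi + 1" | "hi + 1 < i" by linarith
    then show ?thesis
    proof cases
      case 1
      then show ?thesis using Si unfolding Mono by (auto simp: stack_def right_row_def)
    next
      case 2
      then show ?thesis using below[of j] i j range unfolding Mono by (auto simp: stack_def)
    next
      case 3
      then show ?thesis using mono[of i j] l unfolding Mono by (auto simp: stack_def)
    next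
      case 4
      then show ?thesis using above[of j] i j range unfolding Mono by (auto simp: stack_def)
    next
      case 5
      then show ?thesis using Si range unfolding Mono by (auto simp: stack_def left_row_def)
    qed
  qed
qed

text \<open>One row, or two adjacent rows for \<open>Mono\<close>, is changed to break the given
  inequality. The side conditions in \<open>facet_ineqs\<close> are what lets the changed row exist
  and fit between its extreme neighbours.\<close>

lemma facet_ineqs_irredundant:
  assumes k: "k \<in> facet_ineqs"
  shows "\<exists>h :: nat \<Rightarrow> nat \<Rightarrow> int. boundary h \<and> \<not> holds h k \<and> (\<forall>l \<in> facet_ineqs - {k}. holds h l)"
proof (cases k)
  case (Lower i j)
  have i: "1 \<le> i" "i \<le> m" and j: "1 \<le> j" "j = n \<or> j < n" using k Lower by (auto simp: facet_ineqs_def)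
  have Si: "1 \<le> S i" "S i \<le> n - 1" using S_bounds i by auto
  have Sp: "S (i - 1) \<le> S i" using S_mono[of "i - 1" i] i by simp
  have Sn: "S i \<le> S (i + 1)" if "i < m" using S_mono[of i "i + 1"] that by simp
  consider "n = 2" "i = 1" "j = 1" | "S i < n - 1" "j < n" "j = 1 \<longrightarrow> i = 1" | "S i < n - 1" "j = n" "i = m \<or> S i < S (i + 1)" "1 < j"
    using k Lower n j by (cases "j = 1") (auto simp: facet_ineqs_def)
  then show ?thesis
  proof cases
    case 1
    \<comment> \<open>The jump from -1 to 1 also breaks \<open>Upper 1 2\<close>, but this is the
      discarded duplicate of \<open>Lower 1 1\<close>.\<close>
    define z where "z = (\<lambda>i (t::nat). if t = 0 then 0 else if t = 1 then -1 else int (S i))"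
    have t: "t = 1 \<or> t = 2" if "1 \<le> t" "t \<le> n" for t using that 1 by linarith
    show ?thesis
    proof (rule stack_witness[of i i z])
      show "z i' 0 = 0 \<and> z i' n = int (S i')" for i' using n by (simp add: z_def)
      show "right_row (S (i - 1)) t \<le> z i t" if "1 < i" "t \<le> n" for t
        using that 1(2) t[of t] 1(1) Si Sp unfolding right_row_def by (cases "t = 0") (auto simp: z_def)
      show "z i t \<le> left_row (S (i + 1)) t" if "i < m" "t \<le> n" for t
        using that 1(2) t[of t] 1(1) Si Sn unfolding left_row_def by (cases "t = 0") (auto simp: z_def)
      show "z i' (t - 1) \<le> z i' t" if "i \<le> i'" "i' \<le> i" "Lower i' t \<in> facet_ineqs - {k}" for i' t
      proof -
        have "t = 1 \<or> t = 2" using that t[of t] facet_ineqs_subset by (auto simp: all_ineqs_def)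
        then show ?thesis using that[unfolded facet_ineqs_def] 1 Si Lower by (auto simp: z_def)
      qed
      show "z i' t \<le> z i' (t - 1) + 1" if "i \<le> i'" "i' \<le> i" "Upper i' t \<in> facet_ineqs - {k}" for i' t
      proof -
        have "t = 1 \<or> t = 2" using that t[of t] facet_ineqs_subset by (auto simp: all_ineqs_def)
        then show ?thesis using that[unfolded facet_ineqs_def] 1 Si Lower by (auto simp: z_def)
      qed
      show "\<not> holds (stack i i z) k"
        using 1(3) unfolding Lower holds_simps stack_def by (simp add: z_def)
    qed (use i in auto)
  next
    case 2
    \<comment> \<open>Increments: ones as far left as possible, a -1 in column \<open>j\<close>, and
      then the remaining ones. The sum requires \<open>S i + 1\<close> ones in the other n-1
      columns, hence \<open>S i < n - 1\<close>. For \<open>j = 1\<close> the row reaches -1, below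
      every \<open>right_row\<close>, so no row may precede it.\<close>
    define z where "z = (\<lambda>i t. if t < j then min (int t) (int (S i))
      else min (int t - 2) (min (int (S i) - 1 + int t - int j) (int (S i))))"
    show ?thesis
    proof (rule stack_witness[of i i z])
      show "z i' 0 = 0 \<and> z i' n = int (S i')" if "i \<le> i'" "i' \<le> i" for i'
        using that 2 j Si by (auto simp: z_def)
      show "right_row (S (i - 1)) t \<le> z i t" if "1 < i" "t \<le> n" for t
        using that 2 j Si Sp by (auto simp: z_def right_row_def)
      show "z i t \<le> left_row (S (i + 1)) t" if "i < m" "t \<le> n" for t
        using that 2 j Si Sn by (auto simp: z_def left_row_def)
      show "z i' (t - 1) \<le> z i' t" if "i \<le> i'" "i' \<le> i" "Lower i' t \<in> facet_ineqs - {k}" for i' t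
        using that 2 j Si Lower by (auto simp: z_def facet_ineqs_def)
      show "z i' t \<le> z i' (t - 1) + 1" if "i \<le> i'" "i' \<le> i" "Upper i' t \<in> facet_ineqs - {k}" for i' t
        using that 2 j Si Lower by (auto simp: z_def facet_ineqs_def)
      show "\<not> holds (stack i i z) k"
        using 2 j Si unfolding Lower by (auto simp: stack_def z_def)
    qed (use i in auto)
  next
    case 3
    \<comment> \<open>This is \<open>left_row (S i + 1)\<close> with a final increment -1. It
      exceeds \<open>left_row (S i)\<close>, so the next row must have a larger sum or be
      absent.\<close>
    define z where "z = (\<lambda>i t. if t < n then min (int t) (int (S i) + 1) else int (S i))"
    show ?thesis
    proof (rule stack_witness[of i i z])
      show "z i' 0 = 0 \<and> z i' n = int (S i')" if "i \<le> i'" "i' \<le> i" for i'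
        using that 3 j Si by (auto simp: z_def)
      show "right_row (S (i - 1)) t \<le> z i t" if "1 < i" "t \<le> n" for t
        using that 3 j Si Sp by (auto simp: z_def right_row_def)
      show "z i t \<le> left_row (S (i + 1)) t" if "i < m" "t \<le> n" for t
        using that 3 j Si Sn by (auto simp: z_def left_row_def)
      show "z i' (t - 1) \<le> z i' t" if "i \<le> i'" "i' \<le> i" "Lower i' t \<in> facet_ineqs - {k}" for i' t
        using that 3 j Si Lower by (auto simp: z_def facet_ineqs_def)
      show "z i' t \<le> z i' (t - 1) + 1" if "i \<le> i'" "i' \<le> i" "Upper i' t \<in> facet_ineqs - {k}" for i' t
        using that 3 j Si Lower by (auto simp: z_def facet_ineqs_def)
      show "\<not> holds (stack i i z) k"
        using 3 j Si unfolding Lower by (auto simp: stack_def z_def)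
    qed (use i in auto)
  qed
next
  case (Upper i j)
  have i: "1 \<le> i" "i \<le> m" and j: "1 \<le> j" "j = n \<or> j < n" using k Upper by (auto simp: facet_ineqs_def)
  have Si: "1 \<le> S i" "S i \<le> n - 1" using S_bounds i by auto
  have Sp: "S (i - 1) \<le> S i" using S_mono[of "i - 1" i] i by simp
  have Sn: "S i \<le> S (i + 1)" if "i < m" using S_mono[of i "i + 1"] that by simp
  consider "n = 2" "i = m" "j = 1" | "1 < S i" "j < n" "j = 1 \<longrightarrow> i = m" | "1 < S i" "j = n" "S (i - 1) < S i" "1 < j"
    using k Upper n j by (cases "j = 1") (auto simp: facet_ineqs_def)
  then show ?thesis
  proof cases
    case 1
    \<comment> \<open>The drop from 2 to 1 also breaks \<open>Lower m 2\<close>, the discarded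
      duplicate of \<open>Upper m 1\<close>.\<close>
    define z where "z = (\<lambda>i (t::nat). if t = 0 then 0 else if t = 1 then 2 else int (S i))"
    have t: "t = 1 \<or> t = 2" if "1 \<le> t" "t \<le> n" for t using that 1 by linarith
    show ?thesis
    proof (rule stack_witness[of i i z])
      show "z i' 0 = 0 \<and> z i' n = int (S i')" for i' using n by (simp add: z_def)
      show "right_row (S (i - 1)) t \<le> z i t" if "1 < i" "t \<le> n" for t
        using that 1(2) t[of t] 1(1) Si Sp unfolding right_row_def by (cases "t = 0") (auto simp: z_def)
      show "z i t \<le> left_row (S (i + 1)) t" if "i < m" "t \<le> n" for t
        using that 1(2) t[of t] 1(1) Si Sn unfolding left_row_def by (cases "t = 0") (auto simp: z_def)
      show "z i' (t - 1) \<le> z i' t" if "i \<le> i'" "i' \<le> i" "Lower i' t \<in> facet_ineqs - {k}" for i' t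
      proof -
        have "t = 1 \<or> t = 2" using that t[of t] facet_ineqs_subset by (auto simp: all_ineqs_def)
        then show ?thesis using that[unfolded facet_ineqs_def] 1 Si Upper by (auto simp: z_def)
      qed
      show "z i' t \<le> z i' (t - 1) + 1" if "i \<le> i'" "i' \<le> i" "Upper i' t \<in> facet_ineqs - {k}" for i' t
      proof -
        have "t = 1 \<or> t = 2" using that t[of t] facet_ineqs_subset by (auto simp: all_ineqs_def)
        then show ?thesis using that[unfolded facet_ineqs_def] 1 Si Upper by (auto simp: z_def)
      qed
      show "\<not> holds (stack i i z) k"
        using 1(3) unfolding Upper holds_simps stack_def by (simp add: z_def)
    qed (use i in auto)
  next
    case 2
    \<comment> \<open>the row used for \<open>Lower i j\<close>, under the symmetry \<open>H(i,j) \<mapsto> j - H(i,j)\<close>, \<open>S \<mapsto> n - S\<close>\<close>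
    define z where "z = (\<lambda>i t. if t < j then int t - min (int t) (int n - int (S i))
      else int t - min (int t - 2) (min (int n - int (S i) - 1 + int t - int j) (int n - int (S i))))"
    show ?thesis
    proof (rule stack_witness[of i i z])
      show "z i' 0 = 0 \<and> z i' n = int (S i')" if "i \<le> i'" "i' \<le> i" for i'
        using that 2 j Si by (auto simp: z_def)
      show "right_row (S (i - 1)) t \<le> z i t" if "1 < i" "t \<le> n" for t
        using that 2 j Si Sp by (auto simp: z_def right_row_def)
      show "z i t \<le> left_row (S (i + 1)) t" if "i < m" "t \<le> n" for t
        using that 2 j Si Sn by (auto simp: z_def left_row_def)
      show "z i' (t - 1) \<le> z i' t" if "i \<le> i'" "i' \<le> i" "Lower i' t \<in> facet_ineqs - {k}" for i' t
        using that 2 j Si Upper by (auto simp: z_def facet_ineqs_def)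
      show "z i' t \<le> z i' (t - 1) + 1" if "i \<le> i'" "i' \<le> i" "Upper i' t \<in> facet_ineqs - {k}" for i' t
        using that 2 j Si Upper by (auto simp: z_def facet_ineqs_def)
      show "\<not> holds (stack i i z) k"
        using 2 j Si unfolding Upper by (auto simp: stack_def z_def)
    qed (use i in auto)
  next
    case 3
    \<comment> \<open>This is \<open>right_row (S i - 1)\<close> except for a final increment 2; it
      stays above the row before it because \<open>S (i - 1) < S i\<close>.\<close>
    define z where "z = (\<lambda>i t. if t < n then max 0 (int t - int n + int (S i) - 1) else int (S i))"
    show ?thesis
    proof (rule stack_witness[of i i z])
      show "z i' 0 = 0 \<and> z i' n = int (S i')" if "i \<le> i'" "i' \<le> i" for i'
        using that 3 j Si by (auto simp: z_def)
      show "right_row (S (i - 1)) t \<le> z i t" if "1 < i" "t \<le> n" for t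
        using that 3 j Si Sp by (auto simp: z_def right_row_def)
      show "z i t \<le> left_row (S (i + 1)) t" if "i < m" "t \<le> n" for t
        using that 3 j Si Sn by (auto simp: z_def left_row_def)
      show "z i' (t - 1) \<le> z i' t" if "i \<le> i'" "i' \<le> i" "Lower i' t \<in> facet_ineqs - {k}" for i' t
        using that 3 j Si Upper by (auto simp: z_def facet_ineqs_def)
      show "z i' t \<le> z i' (t - 1) + 1" if "i \<le> i'" "i' \<le> i" "Upper i' t \<in> facet_ineqs - {k}" for i' t
        using that 3 j Si Upper by (auto simp: z_def facet_ineqs_def)
      show "\<not> holds (stack i i z) k"
        using 3 j Si unfolding Upper by (auto simp: stack_def z_def)
    qed (use i in auto)
  qed
next
  case (Mono i j)
  have i: "2 \<le> i" "i \<le> m" and j: "1 \<le> j" "S i + j < n + S (i - 1)"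
    using k Mono by (auto simp: facet_ineqs_def)
  \<comment> \<open>the two rows are \<open>u 1 0 v\<close> and \<open>u 0 1 v'\<close> with the 1 and 0 in columns \<open>j\<close> and \<open>j + 1\<close>\<close>
  define a b w where "a = int (S (i - 1))" and "b = int (S i)" and "w = min a (int j)"
  have a: "1 \<le> a" and b: "b \<le> int n - 1" using S_bounds[of "i - 1"] S_bounds[of i] i by (auto simp: a_def b_def)
  have ab: "a \<le> b" using S_mono[of "i - 1" i] i by (simp add: a_def b_def)
  have jn: "b + int j < int n + a" "int j < int n" using j ab by (auto simp: a_def b_def)
  define x where "x = (\<lambda>t. if t < j then min (int t) (a - 1) else if t = j then w
    else w + min (int t - int j - 1) (a - w))"
  define y where "y = (\<lambda>t. if t < j then min (int t) (a - 1) else if t = j then w - 1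
    else w + min (int t - int j - 1) (b - w))"
  define z where "z = (\<lambda>i' t. if i' < i then x t else y t)"
  show ?thesis
  proof (rule stack_witness[of "i - 1" i z])
    \<comment> \<open>The row \<open>y\<close> must place \<open>b - w\<close> ones in the
      \<open>n - j - 1\<close> columns after \<open>j + 1\<close>. If \<open>w = a\<close>, they fit
      by the side condition on \<open>Mono i j\<close>; if \<open>w = j\<close>, by
      \<open>b \<le> n - 1\<close>.\<close>
    have ends: "x 0 = 0" "y 0 = 0" "x n = a" "y n = b"
      using j(1) a b ab jn by (auto simp: x_def y_def w_def)
    then show "z i' 0 = 0 \<and> z i' n = int (S i')" if "i - 1 \<le> i'" "i' \<le> i" for i'
    proof -
      have "i' = i - 1 \<or> i' = i" using that by linarith
      then show ?thesis using ends i by (auto simp: z_def a_def b_def)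
    qed
    show "right_row (S (i - 1 - 1)) t \<le> z (i - 1) t" if "1 < i - 1" "t \<le> n" for t
    proof -
      have "int (S (i - 1 - 1)) \<le> a" using S_mono[of "i - 1 - 1" "i - 1"] i by (simp add: a_def)
      then have "right_row (S (i - 1 - 1)) t \<le> x t"
        using that(2) j(1) a b ab jn by (auto simp: right_row_def x_def w_def)
      then show ?thesis using i by (simp add: z_def)
    qed
    show "z i t \<le> left_row (S (i + 1)) t" if "i < m" "t \<le> n" for t
    proof -
      have "b \<le> int (S (i + 1))" using S_mono[of i "i + 1"] that by (simp add: b_def)
      then have "y t \<le> left_row (S (i + 1)) t"
        using that(2) j(1) a b ab jn by (auto simp: left_row_def y_def w_def)
      then show ?thesis by (simp add: z_def)
    qed
    have xy: "x (t - 1) \<le> x t" "x t \<le> x (t - 1) + 1" "y (t - 1) \<le> y t" "y t \<le> y (t - 1) + 1"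
      if "1 \<le> t" for t
      using j(1) a b ab jn that by (auto simp: x_def y_def w_def)
    show "z i' (t - 1) \<le> z i' t" if "i - 1 \<le> i'" "i' \<le> i" "Lower i' t \<in> facet_ineqs - {k}" for i' t
      using that xy[of t] by (auto simp: z_def facet_ineqs_def)
    show "z i' t \<le> z i' (t - 1) + 1" if "i - 1 \<le> i'" "i' \<le> i" "Upper i' t \<in> facet_ineqs - {k}" for i' t
      using that xy[of t] by (auto simp: z_def facet_ineqs_def)
    show "z (i' - 1) t \<le> z i' t" if "i - 1 < i'" "i' \<le> i" "Mono i' t \<in> facet_ineqs - {k}" for i' t
    proof -
      have "i' = i" "t \<noteq> j" using that Mono by auto
      then show ?thesis using ab i by (auto simp: z_def x_def y_def)
    qed
    show "\<not> holds (stack (i - 1) i z) k"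
      using i unfolding Mono by (auto simp: stack_def z_def x_def y_def)
  qed (use i in auto)
qed

section \<open>An interior point, and the number of kept inequalities\<close>

text \<open>Spreading \<open>S i\<close> evenly over the row gives slopes in [1/n, 1 - 1/n], strict
  for \<open>Lower\<close> and \<open>Upper\<close>, but leaves \<open>Mono\<close> tight between
  rows of equal sum. The added bump j(n-j) vanishes at both ends and grows with i; \<open>e\<close>
  keeps its increments below 1/n.\<close>

lemma facet_ineqs_strictly_feasible:
  "\<exists>h :: nat \<Rightarrow> nat \<Rightarrow> real. boundary h \<and> (\<forall>k\<in>facet_ineqs. form k h < bound k)"
proof (intro exI conjI ballI)
  define e where "e = 1 / (real m * real n ^ 2)"
  define h where "h = (\<lambda>i j. real (S i) * real j / real n + e * real i * (real j * (real n - real j)))"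
  have e: "0 < e" using m n by (simp add: e_def)
  show "boundary h"
    using n by (auto simp: boundary_def h_def S0)
  have diff: "h i j - h i (j - 1) = real (S i) / real n + e * real i * (real n + 1 - 2 * real j)" if "1 \<le> j" for i j
    using that n by (simp add: h_def of_nat_diff field_simps)
  have small: "\<bar>e * real i * (real n + 1 - 2 * real j)\<bar> < 1 / real n"
    if "1 \<le> i" "i \<le> m" "1 \<le> j" "j \<le> n" for i j
  proof -
    have "e * real i \<le> e * real m" using that e by simp
    then have ei: "e * real i \<le> 1 / real n ^ 2" using m by (simp add: e_def)
    have "\<bar>real n + 1 - 2 * real j\<bar> \<le> real n - 1" using that by linarith
    then have "e * real i * \<bar>real n + 1 - 2 * real j\<bar> \<le> 1 / real n ^ 2 * (real n - 1)"
      by (intro mult_mono ei) auto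
    also have "\<dots> < 1 / real n" using n by (simp add: field_simps power2_eq_square)
    finally show ?thesis using e by (simp add: abs_mult)
  qed
  have strict: "h i (j - 1) < h i j" "h i j < h i (j - 1) + 1" if "1 \<le> i" "i \<le> m" "1 \<le> j" "j \<le> n" for i j
  proof -
    have Si: "1 \<le> S i" "S i \<le> n - 1" using S_bounds that by auto
    then have "1 / real n \<le> real (S i) / real n" "real (S i) / real n \<le> 1 - 1 / real n"
      using n by (auto simp: field_simps)
    then show "h i (j - 1) < h i j" "h i j < h i (j - 1) + 1"
      using diff[of j i] small[OF that] that by linarith+
  qed
  fix k assume k: "k \<in> facet_ineqs"
  show "form k h < bound k"
  proof (cases k)
    case (Mono i j)
    then have i: "2 \<le> i" "i \<le> m" "1 \<le> j" "S i + j < n + S (i - 1)" using k by (auto simp: facet_ineqs_def)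
    moreover have Si: "S (i - 1) \<le> S i" using S_mono[of "i - 1" i] i by simp
    ultimately have j: "j < n" by linarith
    have "real (S (i - 1)) * real j / real n \<le> real (S i) * real j / real n"
      using Si n by (intro divide_right_mono mult_right_mono) auto
    moreover have "e * real (i - 1) * (real j * (real n - real j)) < e * real i * (real j * (real n - real j))"
      using e i j by (intro mult_strict_right_mono mult_strict_left_mono) auto
    ultimately show ?thesis unfolding Mono by (simp add: h_def)
  qed (use k strict in \<open>auto simp: facet_ineqs_def algebra_simps\<close>)
qed

lemma card_facet_ineqs:
  "int (card facet_ineqs) =
     of_bool (S 1 < n - 1 \<or> n = 2) + of_bool (1 < S m \<or> n = 2)
     + (int n - 2) * (int (card {i \<in> {1..m}. S i < n - 1}) + int (card {i \<in> {1..m}. 1 < S i}))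
     + 2 * int (card {i \<in> {1..m}. S (i - 1) < S i}) - of_bool (S m = n - 1) - of_bool (S 1 = 1)
     + (int m - 1) * (int n - 1) - int (S m) + int (S 1)"
proof -
  define A where "A = {i \<in> {1..m}. S i < n - 1}"
  define B where "B = {i \<in> {1..m}. 1 < S i}"
  define J where "J = {i \<in> {1..m}. S (i - 1) < S i}"
  define A' where "A' = {i \<in> A. i = m \<or> S i < S (i + 1)}"
  define B' where "B' = {i \<in> B. S (i - 1) < S i}"
  define L1 U1 where "L1 = (if S 1 < n - 1 \<or> n = 2 then {Lower 1 1} else {})"
    and "U1 = (if 1 < S m \<or> n = 2 then {Upper m 1} else {})"
  define L2 U2 where "L2 = (\<lambda>(i, j). Lower i j) ` (A \<times> {2..<n})" and "U2 = (\<lambda>(i, j). Upper i j) ` (B \<times> {2..<n})"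
  define L3 U3 where "L3 = (\<lambda>i. Lower i n) ` A'" and "U3 = (\<lambda>i. Upper i n) ` B'"
  define M where "M = (\<lambda>(i, j). Mono i j) ` (SIGMA i:{2..m}. {1..<n + S (i - 1) - S i})"
  have fin: "finite A" "finite B" "finite A'" "finite B'" "finite J"
    by (auto simp: A_def B_def A'_def B'_def J_def)
  have finU: "finite L1" "finite U1" "finite L2" "finite U2" "finite L3" "finite U3" "finite M"
    using fin by (auto simp: L1_def U1_def L2_def U2_def L3_def U3_def M_def)
  have eq: "facet_ineqs = L1 \<union> (L2 \<union> (L3 \<union> (U1 \<union> (U2 \<union> (U3 \<union> M)))))"
  proof (rule set_eqI)
    fix k show "k \<in> facet_ineqs \<longleftrightarrow> k \<in> L1 \<union> (L2 \<union> (L3 \<union> (U1 \<union> (U2 \<union> (U3 \<union> M)))))"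
    proof (cases k)
      case (Lower i j)
      consider "j = 0" | "j = 1" | "2 \<le> j" "j < n" | "j = n" "2 \<le> j" | "j > n" "2 \<le> j" by linarith
      then show ?thesis
        unfolding Lower using m n
        by cases (auto simp: facet_ineqs_def L1_def U1_def L2_def U2_def L3_def U3_def M_def A_def A'_def B_def B'_def image_iff)
    next
      case (Upper i j)
      consider "j = 0" | "j = 1" | "2 \<le> j" "j < n" | "j = n" "2 \<le> j" | "j > n" "2 \<le> j" by linarith
      then show ?thesis
        unfolding Upper using m n
        by cases (auto simp: facet_ineqs_def L1_def U1_def L2_def U2_def L3_def U3_def M_def A_def A'_def B_def B'_def image_iff)
    next
      case (Mono i j)
      have "S i + j < n + S (i - 1) \<longleftrightarrow> j < n + S (i - 1) - S i" by linarith
      then show ?thesis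
        unfolding Mono by (auto simp: facet_ineqs_def L1_def U1_def L2_def U2_def L3_def U3_def M_def image_iff)
    qed
  qed
  have disj: "L1 \<inter> (L2 \<union> (L3 \<union> (U1 \<union> (U2 \<union> (U3 \<union> M))))) = {}"
    "L2 \<inter> (L3 \<union> (U1 \<union> (U2 \<union> (U3 \<union> M)))) = {}" "L3 \<inter> (U1 \<union> (U2 \<union> (U3 \<union> M))) = {}"
    "U1 \<inter> (U2 \<union> (U3 \<union> M)) = {}" "U2 \<inter> (U3 \<union> M) = {}" "U3 \<inter> M = {}"
    using n by (auto simp: L1_def U1_def L2_def U2_def L3_def U3_def M_def split: if_splits)
  have total: "card facet_ineqs = card L1 + (card L2 + (card L3 + (card U1 + (card U2 + (card U3 + card M)))))"
    unfolding eq by (simp only: card_Un_disjoint finite_Un finU disj simp_thms)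
  have c1: "card L1 = of_bool (S 1 < n - 1 \<or> n = 2)" "card U1 = of_bool (1 < S m \<or> n = 2)"
    by (auto simp: L1_def U1_def)
  have "card L2 = card A * (n - 2)" "card U2 = card B * (n - 2)"
    unfolding L2_def U2_def by (subst card_image; auto simp: inj_on_def card_cartesian_product)+
  then have c2: "int (card L2) = (int n - 2) * int (card A)" "int (card U2) = (int n - 2) * int (card B)"
    using n by (simp_all add: of_nat_diff)
  have c3: "card L3 = card A'" "card U3 = card B'"
    unfolding L3_def U3_def by (subst card_image; auto simp: inj_on_def)+
  have cM: "int (card M) = (int m - 1) * (int n - 1) - int (S m) + int (S 1)"
  proof -
    have "card M = (\<Sum>i\<in>{2..m}. n + S (i - 1) - S i - 1)"
      unfolding M_def by (subst card_image) (auto simp: inj_on_def)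
    also have "int \<dots> = (\<Sum>i\<in>{2..m}. int n - 1 + (int (S (i - 1)) - int (S i)))"
      unfolding of_nat_sum
    proof (rule sum.cong[OF refl])
      fix i assume i: "i \<in> {2..m}"
      \<comment> \<open>This keeps the natural-number subtraction in the summand exact, so the sum
        telescopes over the integers.\<close>
      then have "S i \<le> n - 1" using S_bounds[of i] by simp
      then show "int (n + S (i - 1) - S i - 1) = int n - 1 + (int (S (i - 1)) - int (S i))"
        using n by linarith
    qed
    also have "\<dots> = (int m - 1) * (int n - 1) - int (S m) + int (S 1)"
      using m
    proof (induction m rule: dec_induct)
      case (step k)
      have "{2..Suc k} = insert (Suc k) {2..k}" using step.hyps by auto
      then show ?case using step by (simp add: algebra_simps)
    qed simp
    finally show ?thesis .
  qed
  \<comment> \<open>A jump to the value 1 can occur only in row 1, since all \<open>S i\<close> with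
    \<open>i \<ge> 1\<close> are at least 1.\<close>
  have cB: "int (card B') = int (card J) - of_bool (S 1 = 1)"
  proof -
    have "J = B' \<union> (if S 1 = 1 then {1} else {})"
    proof (rule set_eqI)
      fix i
      have "S (i - 1) < S i \<longleftrightarrow> 1 < S i \<and> S (i - 1) < S i \<or> i = 1 \<and> S 1 = 1" if "1 \<le> i" "i \<le> m"
      proof (cases "i = 1")
        case False
        then have "1 \<le> S (i - 1)" using S_bounds[of "i - 1"] that by linarith
        then show ?thesis using False by auto
      qed (use S0 S1 in auto)
      then show "i \<in> J \<longleftrightarrow> i \<in> B' \<union> (if S 1 = 1 then {1} else {})"
        using m by (auto simp: J_def B'_def B_def)
    qed
    moreover have "B' \<inter> (if S 1 = 1 then {1} else {}) = {}" by (auto simp: B'_def B_def)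
    ultimately have "card J = card B' + card (if S 1 = 1 then {1} else {})"
      using fin by (simp add: card_Un_disjoint)
    then show ?thesis by (auto split: if_splits)
  qed
  have cA: "int (card A') = int (card J) - of_bool (S m = n - 1)"
  proof -
    define A'' where "A'' = {i \<in> {1..m}. i = m \<or> S i < S (i + 1)}"
    have "A'' = A' \<union> (if S m = n - 1 then {m} else {})"
    proof (rule set_eqI)
      fix i
      have "i = m \<or> S i < S (i + 1) \<longleftrightarrow> S i < n - 1 \<and> (i = m \<or> S i < S (i + 1)) \<or> i = m \<and> S m = n - 1" if "1 \<le> i" "i \<le> m"
      proof (cases "i = m")
        case True
        then show ?thesis using S_bounds[of m] m by auto
      next
        case False
        then have "S (i + 1) \<le> n - 1" using S_bounds[of "i + 1"] that by simp
        then show ?thesis using False by auto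
      qed
      then show "i \<in> A'' \<longleftrightarrow> i \<in> A' \<union> (if S m = n - 1 then {m} else {})"
        using m by (auto simp: A''_def A'_def A_def)
    qed
    moreover have "A' \<inter> (if S m = n - 1 then {m} else {}) = {}" by (auto simp: A'_def A_def)
    ultimately have "card A'' = card A' + card (if S m = n - 1 then {m} else {})"
      using fin by (simp add: card_Un_disjoint)
    \<comment> \<open>The last row of each run of equal sums is sent to the first row of the next
      run, cyclically.\<close>
    moreover have "card A'' = card J"
    proof (rule bij_betw_same_card)
      show "bij_betw (\<lambda>i. if i = m then 1 else i + 1) A'' J"
        by (rule bij_betw_byWitness[where f' = "\<lambda>i. if i = 1 then m else i - 1"])
          (use m S0 S1 in \<open>auto simp: A''_def J_def\<close>)
    qed
    ultimately show ?thesis by (auto split: if_splits)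
  qed
  show ?thesis
    unfolding total of_nat_add c1 c2 c3 cM cA cB A_def[symmetric] B_def[symmetric] J_def[symmetric] of_nat_of_bool distrib_left
    by linarith
qed

end

section \<open>Matrices and corner sums\<close>

type_synonym ('r, 'c) real_matrix = "real^'c^'r"

lemma pos_le_iff: "pos x \<le> pos y \<longleftrightarrow> x \<le> y"
proof
  show "x \<le> y \<Longrightarrow> pos x \<le> pos y" unfolding pos_def by (intro card_mono) auto
  have "pos y < pos x" if "y < x" unfolding pos_def
    using that by (intro psubset_card_mono) auto
  then show "pos x \<le> pos y \<Longrightarrow> x \<le> y" by (meson not_le)
qed

lemma pos_eq_iff: "pos x = pos y \<longleftrightarrow> x = y"
  by (metis order_antisym_conv order_refl pos_le_iff)

lemma pos_ge_1: "1 \<le> pos x"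
  unfolding pos_def by (metis Suc_le_eq One_nat_def atMost_iff card_gt_0_iff empty_iff finite order_refl)

lemma pos_neq_0 [simp]: "pos x \<noteq> 0"
  using pos_ge_1[of x] by simp

lemma bij_betw_pos: "bij_betw pos (UNIV :: 'a::{finite,linorder} set) {1..CARD('a)}"
proof -
  have inj: "inj (pos :: 'a \<Rightarrow> nat)" by (simp add: inj_def pos_eq_iff)
  have "range (pos :: 'a \<Rightarrow> nat) \<subseteq> {1..CARD('a)}"
    using pos_ge_1 by (auto simp: pos_def intro!: card_mono)
  then have "range (pos :: 'a \<Rightarrow> nat) = {1..CARD('a)}"
    by (intro card_subset_eq) (auto simp: card_image[OF inj])
  with inj show ?thesis by (simp add: bij_betw_def)
qed

lemma pos_le_card: "pos (x :: 'a::{finite,linorder}) \<le> CARD('a)"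
  using bij_betw_pos[where 'a='a] by (auto simp: bij_betw_def)

lemma pos_surj:
  assumes "1 \<le> i" "i \<le> CARD('a::{finite,linorder})"
  shows "\<exists>x :: 'a. pos x = i"
proof -
  have "i \<in> range (pos :: 'a \<Rightarrow> nat)"
    using bij_betw_pos[where 'a='a] assms by (simp add: bij_betw_def)
  then show ?thesis by auto
qed

lemma sum_pos_le:
  assumes "i \<le> CARD('a::{finite,linorder})"
  shows "(\<Sum>x :: 'a | pos x \<le> i. g (pos x)) = (\<Sum>p\<in>{1..i}. g p)"
proof -
  have "pos ` {x :: 'a. pos x \<le> i} = range (pos :: 'a \<Rightarrow> nat) \<inter> {..i}" by auto
  also have "\<dots> = {1..i}" using bij_betw_pos[where 'a='a] assms by (auto simp: bij_betw_def)
  finally have "bij_betw pos {x :: 'a. pos x \<le> i} {1..i}"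
    using bij_betw_pos[where 'a='a] by (auto intro: bij_betw_subset)
  then show ?thesis by (rule sum.reindex_bij_betw)
qed

lemma sum_pos_step:
  "(\<Sum>x | pos x \<le> pos y. g x) = (\<Sum>x | pos x \<le> pos y - 1. g x) + g y"
proof -
  have "{x. pos x \<le> pos y} = insert y {x. pos x \<le> pos y - 1}"
    using pos_ge_1[of y] by (auto simp: pos_eq_iff[symmetric])
  moreover have "y \<notin> {x. pos x \<le> pos y - 1}" using pos_ge_1[of y] by auto
  ultimately show ?thesis by (simp add: add.commute)
qed

lemma sum_diff_telescope:
  fixes g :: "nat \<Rightarrow> 'a::ab_group_add"
  shows "(\<Sum>p\<in>{1..i}. g p - g (p - 1)) = g i - g 0"
  by (induction i) auto

definition corner_sum :: "('r::{finite,linorder}, 'c::{finite,linorder}) real_matrix \<Rightarrow> nat \<Rightarrow> nat \<Rightarrow> real" where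
  "corner_sum A i j = (\<Sum>r | pos r \<le> i. \<Sum>c | pos c \<le> j. A $ r $ c)"

text \<open>The mixed second difference, inverse to \<open>corner_sum\<close> on arrays that vanish
  in row 0 and column 0.\<close>

definition matrix_of :: "(nat \<Rightarrow> nat \<Rightarrow> real) \<Rightarrow> ('r::{finite,linorder}, 'c::{finite,linorder}) real_matrix" where
  "matrix_of h = (\<chi> r c. (h (pos r) (pos c) - h (pos r - 1) (pos c))
     - (h (pos r) (pos c - 1) - h (pos r - 1) (pos c - 1)))"

lemma corner_sum_zero [simp]: "corner_sum A 0 j = 0" "corner_sum A i 0 = 0"
  by (simp_all add: corner_sum_def)

lemma corner_sum_matrix_of:
  fixes h :: "nat \<Rightarrow> nat \<Rightarrow> real"
  assumes "i \<le> CARD('r::{finite,linorder})" "j \<le> CARD('c::{finite,linorder})"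
    and "\<And>j. j \<le> CARD('c) \<Longrightarrow> h 0 j = 0" "\<And>i. i \<le> CARD('r) \<Longrightarrow> h i 0 = 0"
  shows "corner_sum (matrix_of h :: ('r, 'c) real_matrix) i j = h i j"
proof -
  have "corner_sum (matrix_of h :: ('r, 'c) real_matrix) i j
    = (\<Sum>p\<in>{1..i}. \<Sum>q\<in>{1..j}. (h p q - h (p - 1) q) - (h p (q - 1) - h (p - 1) (q - 1)))"
    using sum_pos_le[OF assms(1), of "\<lambda>p. \<Sum>c :: 'c | pos c \<le> j. (h p (pos c) - h (p - 1) (pos c)) - (h p (pos c - 1) - h (p - 1) (pos c - 1))"]
      sum_pos_le[OF assms(2), of "\<lambda>q. (h _ q - h (_ - 1) q) - (h _ (q - 1) - h (_ - 1) (q - 1))"]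
    by (simp add: corner_sum_def matrix_of_def)
  also have "\<dots> = (\<Sum>p\<in>{1..i}. (h p j - h (p - 1) j) - (h p 0 - h (p - 1) 0))"
    by (intro sum.cong refl sum_diff_telescope[of "\<lambda>q. h _ q - h (_ - 1) q"])
  also have "\<dots> = (\<Sum>p\<in>{1..i}. h p j - h (p - 1) j)"
    using assms by (intro sum.cong refl) auto
  also have "\<dots> = h i j" using sum_diff_telescope[of "\<lambda>p. h p j" i] assms by simp
  finally show ?thesis .
qed

lemma corner_sum_row:
  "corner_sum A (pos r) j - corner_sum A (pos r - 1) j = (\<Sum>c | pos c \<le> j. A $ r $ c)"
  unfolding corner_sum_def by (subst sum_pos_step) simp

lemma corner_sum_column:
  "corner_sum A i (pos c) - corner_sum A i (pos c - 1) = (\<Sum>r | pos r \<le> i. A $ r $ c)"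
  unfolding corner_sum_def by (subst sum_pos_step) (simp add: sum.distrib)

lemma entry_corner_sum:
  "A $ r $ c = (corner_sum A (pos r) (pos c) - corner_sum A (pos r) (pos c - 1))
     - (corner_sum A (pos r - 1) (pos c) - corner_sum A (pos r - 1) (pos c - 1))"
  unfolding corner_sum_column by (subst sum_pos_step) simp

lemma corner_sum_lincomb:
  "corner_sum (a *\<^sub>R A + b *\<^sub>R B) i j = a * corner_sum A i j + b * corner_sum B i j"
  by (simp add: corner_sum_def sum.distrib sum_distrib_left)

lemma linear_corner_sum: "linear (\<lambda>A. corner_sum A i j)"
  by (rule linearI) (simp_all add: corner_sum_def sum.distrib sum_distrib_left)

lemma linear_form: "linear (\<lambda>A. form k (corner_sum A))"
  by (cases k) (auto intro: linear_compose_sub linear_corner_sum)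

section \<open>The feasible polytope: facets, compactness, integrality\<close>

context row_sums begin

definition feasible :: "(nat \<Rightarrow> nat \<Rightarrow> real) \<Rightarrow> bool" where
  "feasible h \<longleftrightarrow> boundary h \<and> (\<forall>k\<in>all_ineqs. holds h k)"

lemma finite_all_ineqs: "finite all_ineqs"
  unfolding all_ineqs_def by (intro finite_UnI finite_image_set2) auto

text \<open>Corner sums stay constant beyond the size of the matrix, so they agree with a given
  array only for \<open>i \<le> m\<close>, \<open>j \<le> n\<close>; the inequalities look no
  further.\<close>

lemma form_cong:
  assumes "\<And>i j. i \<le> m \<Longrightarrow> j \<le> n \<Longrightarrow> g i j = h i j" "k \<in> all_ineqs"
  shows "form k g = form k h"
  using assms by (auto simp: all_ineqs_def)

lemma boundary_cong:
  assumes "\<And>i j. i \<le> m \<Longrightarrow> j \<le> n \<Longrightarrow> g i j = h i j"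
  shows "boundary g \<longleftrightarrow> boundary h"
  using assms by (auto simp: boundary_def)

lemma boundary_corner_sum_matrix_of:
  assumes "CARD('r::{finite,linorder}) = m" "CARD('c::{finite,linorder}) = n" "boundary h"
  shows "boundary (corner_sum (matrix_of h :: ('r, 'c) real_matrix))"
    and "k \<in> all_ineqs \<Longrightarrow> form k (corner_sum (matrix_of h :: ('r, 'c) real_matrix)) = form k h"
proof -
  have *: "corner_sum (matrix_of h :: ('r, 'c) real_matrix) i j = h i j" if "i \<le> m" "j \<le> n" for i j
    using assms that by (intro corner_sum_matrix_of) (auto simp: boundary_def)
  show "boundary (corner_sum (matrix_of h :: ('r, 'c) real_matrix))"
    using boundary_cong[OF *] assms by simp
  show "form k (corner_sum (matrix_of h :: ('r, 'c) real_matrix)) = form k h" if "k \<in> all_ineqs"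
    using form_cong[OF * that] by simp
qed

lemma affine_boundary: "affine {A :: ('r::{finite,linorder}, 'c::{finite,linorder}) real_matrix. boundary (corner_sum A)}"
  unfolding affine_def
  by (auto simp: boundary_def corner_sum_lincomb simp flip: distrib_right)

lemma feasible_iff_facet_ineqs:
  "feasible h \<longleftrightarrow> boundary h \<and> (\<forall>k\<in>facet_ineqs. form k h \<le> bound k)"
  unfolding feasible_def using facet_ineqs_suffice[of h] facet_ineqs_subset
  by (auto simp: holds_def)

lemma card_facets_feasible:
  assumes card: "CARD('r::{finite,linorder}) = m" "CARD('c::{finite,linorder}) = n"
  shows "card {F. F facet_of {A :: ('r, 'c) real_matrix. feasible (corner_sum A)}} = card facet_ineqs"
proof -
  obtain h0 :: "nat \<Rightarrow> nat \<Rightarrow> real" where h0: "boundary h0" "\<And>k. k \<in> facet_ineqs \<Longrightarrow> form k h0 < bound k"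
    using facet_ineqs_strictly_feasible by blast
  have "\<forall>k\<in>facet_ineqs. \<exists>h :: nat \<Rightarrow> nat \<Rightarrow> int. boundary h \<and> \<not> holds h k \<and> (\<forall>l \<in> facet_ineqs - {k}. holds h l)"
    using facet_ineqs_irredundant by blast
  then obtain w :: "ineq \<Rightarrow> nat \<Rightarrow> nat \<Rightarrow> int"
    where "\<forall>k\<in>facet_ineqs. boundary (w k) \<and> \<not> holds (w k) k \<and> (\<forall>l \<in> facet_ineqs - {k}. holds (w k) l)"
    by (auto dest!: bchoice)
  then have w: "\<And>k. k \<in> facet_ineqs \<Longrightarrow> boundary (w k)" "\<And>k. k \<in> facet_ineqs \<Longrightarrow> \<not> holds (w k) k"
      "\<And>k l. k \<in> facet_ineqs \<Longrightarrow> l \<in> facet_ineqs \<Longrightarrow> l \<noteq> k \<Longrightarrow> holds (w k) l"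
    by auto
  define u where "u = (\<lambda>k i j. real_of_int (w k i j))"
  have form_u: "form l (u k) = real_of_int (form l (w k))" for k l by (cases l) (auto simp: u_def)
  have bound_u: "(bound l :: real) = real_of_int (bound l)" for l by (cases l) auto
  have u: "boundary (u k)" "bound k < form k (u k)" if "k \<in> facet_ineqs" for k
    using w(1,2)[OF that] by (auto simp: boundary_def u_def) (auto simp: holds_def form_u[unfolded u_def] bound_u)
  have u_sat: "form l (u k) \<le> bound l" if "k \<in> facet_ineqs" "l \<in> facet_ineqs" "l \<noteq> k" for k l
    using w(3)[OF that] by (auto simp: holds_def form_u bound_u)
  note to_matrix = boundary_corner_sum_matrix_of[OF card]
  have all: "k \<in> facet_ineqs \<Longrightarrow> k \<in> all_ineqs" for k using facet_ineqs_subset by auto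
  show ?thesis
  proof (rule card_facets_irredundant_system)
    show "affine {A :: ('r, 'c) real_matrix. boundary (corner_sum A)}" by (rule affine_boundary)
    show "finite facet_ineqs" using finite_subset[OF facet_ineqs_subset finite_all_ineqs] .
    show "linear (\<lambda>A :: ('r, 'c) real_matrix. form k (corner_sum A))" for k by (rule linear_form)
    show "(matrix_of h0 :: ('r, 'c) real_matrix) \<in> {A. boundary (corner_sum A)}"
      using to_matrix(1)[OF h0(1)] by simp
    show "form k (corner_sum (matrix_of h0 :: ('r, 'c) real_matrix)) < bound k" if "k \<in> facet_ineqs" for k
      using h0 to_matrix(2)[OF h0(1) all] that by simp
    show "(matrix_of (u k) :: ('r, 'c) real_matrix) \<in> {A. boundary (corner_sum A)}" if "k \<in> facet_ineqs" for k
      using to_matrix(1)[OF u(1)] that by simp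
    show "bound k < form k (corner_sum (matrix_of (u k) :: ('r, 'c) real_matrix))" if "k \<in> facet_ineqs" for k
      using u(2) to_matrix(2)[OF u(1) all] that by simp
    show "form l (corner_sum (matrix_of (u k) :: ('r, 'c) real_matrix)) \<le> bound l"
      if "k \<in> facet_ineqs" "l \<in> facet_ineqs" "l \<noteq> k" for k l
      using u_sat to_matrix(2)[OF u(1) all] that by simp
    show "{A :: ('r, 'c) real_matrix. feasible (corner_sum A)} =
      {A \<in> {A. boundary (corner_sum A)}. \<forall>k\<in>facet_ineqs. form k (corner_sum A) \<le> bound k}"
      by (auto simp: feasible_iff_facet_ineqs)
  qed
qed

lemma feasible_lincomb:
  assumes "feasible (corner_sum A)" "feasible (corner_sum B)" "0 \<le> a" "0 \<le> b" "a + b = 1"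
  shows "feasible (corner_sum (a *\<^sub>R A + b *\<^sub>R B))"
proof -
  have "boundary (corner_sum (a *\<^sub>R A + b *\<^sub>R B))"
    using affine_boundary assms unfolding affine_def feasible_def by blast
  moreover have "form k (corner_sum (a *\<^sub>R A + b *\<^sub>R B)) \<le> bound k" if "k \<in> all_ineqs" for k
  proof -
    interpret linear "\<lambda>A. form k (corner_sum A)" by (rule linear_form)
    have "a * form k (corner_sum A) + b * form k (corner_sum B) \<le> a * bound k + b * bound k"
      using assms that by (intro add_mono mult_left_mono) (auto simp: feasible_def holds_def)
    then show ?thesis using assms(5) by (simp add: add scale flip: distrib_right)
  qed
  ultimately show ?thesis by (simp add: feasible_def holds_def)
qed

lemma compact_feasible:
  assumes card: "CARD('r::{finite,linorder}) = m" "CARD('c::{finite,linorder}) = n"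
  shows "compact {A :: ('r, 'c) real_matrix. feasible (corner_sum A)}"
proof -
  have "\<bar>A $ r $ c\<bar> \<le> 1" if A: "feasible (corner_sum A)" for A :: "('r, 'c) real_matrix" and r c
  proof -
    let ?h = "corner_sum A"
    \<comment> \<open>An entry is the difference of two such column partial sums, hence lies in
      [-1,1].\<close>
    have d: "0 \<le> ?h i (pos c) - ?h i (pos c - 1) \<and> ?h i (pos c) - ?h i (pos c - 1) \<le> 1" if "i \<le> m" for i
    proof (cases "i = 0")
      case False
      then have "Lower i (pos c) \<in> all_ineqs" "Upper i (pos c) \<in> all_ineqs"
        using that pos_ge_1[of c] pos_le_card[of c] card by (auto simp: all_ineqs_def)
      then have "holds ?h (Lower i (pos c))" "holds ?h (Upper i (pos c))"
        using A by (auto simp: feasible_def)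
      then show ?thesis by simp
    qed simp
    show ?thesis
      using d[of "pos r"] d[of "pos r - 1"] pos_le_card[of r] card
      by (subst entry_corner_sum) linarith
  qed
  then have "norm A \<le> (\<Sum>r\<in>(UNIV::'r set). \<Sum>c\<in>(UNIV::'c set). 1)" if "feasible (corner_sum A)" for A :: "('r, 'c) real_matrix"
  proof -
    have "norm A \<le> (\<Sum>r\<in>UNIV. norm (A $ r))" by (auto simp: norm_vec_def intro!: L2_set_le_sum)
    also have "\<dots> \<le> (\<Sum>r\<in>UNIV. \<Sum>c\<in>UNIV. \<bar>A $ r $ c\<bar>)" by (intro sum_mono norm_le_l1_cart)
    also have "\<dots> \<le> (\<Sum>r\<in>(UNIV::'r set). \<Sum>c\<in>(UNIV::'c set). 1)"
      using \<open>\<And>c r A. feasible (corner_sum A) \<Longrightarrow> \<bar>A $ r $ c\<bar> \<le> 1\<close> that by (intro sum_mono) auto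
    finally show ?thesis .
  qed
  then have "bounded {A :: ('r, 'c) real_matrix. feasible (corner_sum A)}" by (auto simp: bounded_iff)
  moreover have "closed {A :: ('r, 'c) real_matrix. feasible (corner_sum A)}"
  proof -
    have cont: "continuous_on UNIV f" if "linear f" for f :: "('r, 'c) real_matrix \<Rightarrow> real"
      using that by (simp add: linear_continuous_on linear_conv_bounded_linear)
    have "{A :: ('r, 'c) real_matrix. feasible (corner_sum A)} =
      (\<Inter>i\<in>{..m}. {A. corner_sum A i n = real (S i)}) \<inter> (\<Inter>k\<in>all_ineqs. {A. form k (corner_sum A) \<le> bound k})"
      by (auto simp: feasible_def boundary_def holds_def)
    moreover have "closed {A :: ('r, 'c) real_matrix. corner_sum A i n = real (S i)}" for i
      by (intro closed_Collect_eq cont linear_corner_sum continuous_on_const)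
    moreover have "closed {A :: ('r, 'c) real_matrix. form k (corner_sum A) \<le> bound k}" for k
      by (intro closed_Collect_le cont linear_form continuous_on_const)
    ultimately show ?thesis by (simp add: closed_Int closed_INT)
  qed
  ultimately show ?thesis by (simp add: compact_eq_bounded_closed)
qed

lemma form_lincomb: "form k (\<lambda>i j. g i j + t * h i j) = form k g + t * form k h"
  by (cases k) (auto simp: algebra_simps)

text \<open>All corner sums of a feasible matrix that lie in one fractional class can be shifted by the
  same small amount in both directions, so the corner sums of an extreme point are integers.\<close>

lemma extreme_feasible_integral:
  fixes A :: "('r::{finite,linorder}, 'c::{finite,linorder}) real_matrix"
  assumes card: "CARD('r) = m" "CARD('c) = n"
    and ext: "A extreme_point_of {A. feasible (corner_sum A)}" and "i \<le> m" "j \<le> n"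
  shows "corner_sum A i j \<in> \<int>"
proof (rule ccontr)
  assume nonint: "corner_sum A i j \<notin> \<int>"
  let ?h = "corner_sum A"
  have feas: "feasible ?h" using ext by (simp add: extreme_point_of_def)
  define d where "d = (\<lambda>p q. if ?h p q - ?h i j \<in> \<int> then 1 else 0 :: real)"
  define B where "B = (matrix_of d :: ('r, 'c) real_matrix)"
  \<comment> \<open>The class of a non-integer contains no integers, so the shift leaves all
    boundary values fixed.\<close>
  have d0: "d p q = 0" if "?h p q \<in> \<int>" for p q
  proof -
    have "?h p q - ?h i j \<notin> \<int>"
    proof
      assume "?h p q - ?h i j \<in> \<int>"
      then have "?h p q - (?h p q - ?h i j) \<in> \<int>" using that by (rule_tac Ints_diff)
      then show False using nonint by simp
    qed
    then show ?thesis by (simp add: d_def)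
  qed
  have hB: "corner_sum B p q = d p q" if "p \<le> m" "q \<le> n" for p q
    unfolding B_def using card that by (intro corner_sum_matrix_of d0) auto
  have dn: "d p n = 0" if "p \<le> m" for p
    using feas that by (intro d0) (auto simp: feasible_def boundary_def)
  have diff: "d p q = d p' q'" if "?h p q - ?h p' q' \<in> \<int>" for p q p' q'
  proof -
    have "?h p q - ?h i j \<in> \<int> \<longleftrightarrow> ?h p' q' - ?h i j \<in> \<int>"
      using Ints_diff[OF _ that, of "?h p q - ?h i j"] Ints_add[OF that, of "?h p' q' - ?h i j"]
      by (auto simp: algebra_simps)
    then show ?thesis by (simp add: d_def)
  qed
  have "\<exists>e>0. \<forall>t. \<bar>t\<bar> \<le> e \<longrightarrow> form k ?h + t * form k d \<le> bound k" if k: "k \<in> all_ineqs" for k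
  proof (cases "form k d = 0")
    case True
    then show ?thesis using feas k by (auto simp: feasible_def holds_def intro: exI[of _ 1])
  next
    case False
    \<comment> \<open>In a tight constraint two corner sums differ by an integer, so they lie in the
      same class and move together. This is where difference constraints with integral bounds are
      essential.\<close>
    have "form k ?h \<noteq> bound k"
    proof
      assume "form k ?h = bound k"
      then have "form k ?h \<in> \<int>" by (cases k) auto
      then have "form k d = 0" using diff by (cases k) auto
      with False show False ..
    qed
    then have "form k ?h < bound k" using feas k by (simp add: feasible_def holds_def less_le)
    \<comment> \<open>Hence the slack of a constraint is itself an admissible shift.\<close>
    moreover have "\<bar>form k d\<bar> \<le> 1" by (cases k) (auto simp: d_def)
    then have "t * form k d \<le> \<bar>t\<bar>" for t
      by (metis abs_ge_zero abs_mult abs_le_D1 mult.right_neutral mult_left_mono order_refl)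
    ultimately show ?thesis
      by (intro exI[of _ "bound k - form k ?h"] conjI allI impI) (auto, smt (verit))
  qed
  then obtain e where e: "\<And>k. k \<in> all_ineqs \<Longrightarrow> 0 < e k"
    and e': "\<And>k t. k \<in> all_ineqs \<Longrightarrow> \<bar>t\<bar> \<le> e k \<Longrightarrow> form k ?h + t * form k d \<le> bound k"
    by metis
  define s where "s = Min (insert 1 (e ` all_ineqs))"
  have s: "0 < s" "\<And>k. k \<in> all_ineqs \<Longrightarrow> s \<le> e k"
    using e finite_all_ineqs by (auto simp: s_def)
  have feas_shift: "feasible (corner_sum (A + t *\<^sub>R B))" if "\<bar>t\<bar> \<le> s" for t
  proof -
    have h: "corner_sum (A + t *\<^sub>R B) p q = ?h p q + t * d p q" if "p \<le> m" "q \<le> n" for p q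
      using corner_sum_lincomb[of 1 A t B p q] hB[OF that] by simp
    have "boundary (corner_sum (A + t *\<^sub>R B))"
      using feas dn by (auto simp: boundary_def feasible_def h)
    moreover have "form k (corner_sum (A + t *\<^sub>R B)) \<le> bound k" if "k \<in> all_ineqs" for k
      using form_cong[of "corner_sum (A + t *\<^sub>R B)" "\<lambda>p q. ?h p q + t * d p q" k] h that
        e'[OF that, of t] s(2)[OF that] \<open>\<bar>t\<bar> \<le> s\<close> by (simp add: form_lincomb)
    ultimately show ?thesis by (simp add: feasible_def holds_def)
  qed
  have "corner_sum B i j \<noteq> 0" using hB assms by (simp add: d_def)
  then have "B \<noteq> 0" by (auto simp: corner_sum_def)
  then have "A - s *\<^sub>R B \<noteq> A + s *\<^sub>R B" using s(1)
    by (simp add: algebra_simps flip: scaleR_left.add)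
  moreover have "A = midpoint (A - s *\<^sub>R B) (A + s *\<^sub>R B)"
    by (simp add: midpoint_def flip: scaleR_2)
  ultimately have "A \<in> open_segment (A - s *\<^sub>R B) (A + s *\<^sub>R B)"
    by (metis midpoint_in_open_segment)
  moreover have "feasible (corner_sum (A - s *\<^sub>R B))" "feasible (corner_sum (A + s *\<^sub>R B))"
    using feas_shift[of "- s"] feas_shift[of s] s(1) by auto
  ultimately show False using ext by (auto simp: extreme_point_of_def)
qed

lemma convex_hull_integral_feasible:
  assumes card: "CARD('r::{finite,linorder}) = m" "CARD('c::{finite,linorder}) = n"
  shows "convex hull {A :: ('r, 'c) real_matrix. feasible (corner_sum A) \<and> (\<forall>i\<le>m. \<forall>j\<le>n. corner_sum A i j \<in> \<int>)}
    = {A. feasible (corner_sum A)}" (is "convex hull ?I = ?Q")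
proof
  have conv: "convex ?Q" by (rule convexI) (simp add: feasible_lincomb)
  then show "convex hull ?I \<subseteq> ?Q" by (intro hull_minimal) auto
  have "?Q = convex hull {x. x extreme_point_of ?Q}"
    by (rule Krein_Milman_Minkowski[OF compact_feasible[OF card] conv])
  also have "\<dots> \<subseteq> convex hull ?I"
    using extreme_feasible_integral[OF card] by (intro hull_mono) (auto simp: extreme_point_of_def)
  finally show "?Q \<subseteq> convex hull ?I" .
qed

end

section \<open>Partitions\<close>

text \<open>Column partial sums are differences of corner sums in j, row partial sums are
  differences in i. Integrality turns the interval [0,1] into {0,1}, and entries, as differences of
  two such values, then lie in {-1,0,1}.\<close>

lemma sign_matrix_feasible_iff:
  fixes A :: "('r::{finite,linorder}, 'c::{finite,linorder}) real_matrix"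
  assumes "row_sums m n S" and card: "CARD('r) = m" "CARD('c) = n"
  shows "sign_matrix A \<and> (\<forall>r. (\<Sum>c\<in>UNIV. A $ r $ c) = real (S (pos r)) - real (S (pos r - 1)))
    \<longleftrightarrow> row_sums.feasible m n S (corner_sum A) \<and> (\<forall>i\<le>m. \<forall>j\<le>n. corner_sum A i j \<in> \<int>)"
    (is "?sign \<longleftrightarrow> ?feas")
proof -
  interpret row_sums m n S by fact
  let ?h = "corner_sum A"
  have row: "?h (pos r) (pos c) - ?h (pos r - 1) (pos c) = (\<Sum>c'\<in>{..c}. A $ r $ c')" for r c
    by (simp only: corner_sum_row pos_le_iff atMost_def)
  have column: "?h (pos r) (pos c) - ?h (pos r) (pos c - 1) = (\<Sum>r'\<in>{..r}. A $ r' $ c)" for r c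
    by (simp only: corner_sum_column pos_le_iff atMost_def)
  have full_row: "?h (pos r) n - ?h (pos r - 1) n = (\<Sum>c\<in>UNIV. A $ r $ c)" for r
    unfolding corner_sum_row using pos_le_card[where 'a='c] card by simp
  have row_at: "\<exists>r :: 'r. pos r = i" if "1 \<le> i" "i \<le> m" for i
    using that card pos_surj[where 'a='r] by simp
  have column_at: "\<exists>c :: 'c. pos c = j" if "1 \<le> j" "j \<le> n" for j
    using that card pos_surj[where 'a='c] by simp
  show ?thesis
  proof
    assume sign: ?sign
    have "A $ r $ c \<in> \<int>" for r c
    proof -
      have "A $ r $ c \<in> {-1, 0, 1}" using sign by (simp add: sign_matrix_def)
      then show ?thesis by auto
    qed
    then have int: "?h i j \<in> \<int>" for i j
      unfolding corner_sum_def by (intro Ints_sum)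
    have "?h i n = real (S i)" if "i \<le> m" for i
      using that
    proof (induction i)
      case (Suc i)
      then obtain r :: 'r where "pos r = Suc i" using row_at[of "Suc i"] by auto
      then show ?case using full_row[of r] sign Suc by simp
    qed (simp add: S0)
    then have "boundary ?h" by (simp add: boundary_def)
    moreover have "holds ?h k" if k: "k \<in> all_ineqs" for k
    proof -
      obtain i j where ij: "1 \<le> i" "i \<le> m" "1 \<le> j" "j \<le> n" and
        k: "k = Lower i j \<or> k = Upper i j \<or> k = Mono i j"
        using k by (auto simp: all_ineqs_def)
      obtain r :: 'r and c :: 'c where rc: "pos r = i" "pos c = j"
        using row_at column_at ij by blast
      have "?h i j - ?h i (j - 1) \<in> {0, 1}" "0 \<le> ?h i j - ?h (i - 1) j"
        using sign row[of r c] column[of r c] by (auto simp: sign_matrix_def rc)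
      then show ?thesis using k by auto
    qed
    ultimately show ?feas using int by (simp add: feasible_def)
  next
    assume feas: ?feas
    have col01: "?h i (pos c) - ?h i (pos c - 1) \<in> {0, 1}" if "i \<le> m" for i and c :: 'c
    proof (cases "i = 0")
      case False
      have c: "1 \<le> pos c" "pos c \<le> n" using pos_ge_1[of c] pos_le_card[of c] card by auto
      then have "Lower i (pos c) \<in> all_ineqs" "Upper i (pos c) \<in> all_ineqs"
        using False that by (auto simp: all_ineqs_def)
      then have "holds ?h (Lower i (pos c))" "holds ?h (Upper i (pos c))"
        using feas by (auto simp: feasible_def)
      moreover have "?h i (pos c) - ?h i (pos c - 1) \<in> \<int>"
        using feas that c by (intro Ints_diff) auto
      then obtain z where "?h i (pos c) - ?h i (pos c - 1) = of_int z" by (auto elim: Ints_cases)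
      ultimately have "0 \<le> z" "z \<le> 1" "?h i (pos c) - ?h i (pos c - 1) = of_int z" by auto
      then show ?thesis by (cases "z = 0") auto
    qed simp
    have pr: "1 \<le> pos r" "pos r \<le> m" for r :: 'r using pos_ge_1[of r] pos_le_card[of r] card by auto
    have "A $ r $ c \<in> {-1, 0, 1}" for r c
    proof -
      have "pos r - 1 \<le> m" using pr[of r] by simp
      then show ?thesis
        using col01[OF pr(2)[of r], of c] col01[of "pos r - 1" c] by (subst entry_corner_sum) auto
    qed
    moreover have "0 \<le> (\<Sum>c'\<in>{..c}. A $ r $ c')" for r c
    proof -
      have "Mono (pos r) (pos c) \<in> all_ineqs"
        using pr[of r] pos_ge_1[of c] pos_le_card[of c] card by (auto simp: all_ineqs_def)
      then have "holds ?h (Mono (pos r) (pos c))" using feas by (auto simp: feasible_def)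
      then show ?thesis by (simp flip: row)
    qed
    moreover have "(\<Sum>r'\<in>{..r}. A $ r' $ c) \<in> {0, 1}" for r c
      using col01[OF pr(2)[of r], of c] by (simp only: column)
    moreover have "(\<Sum>c\<in>UNIV. A $ r $ c) = real (S (pos r)) - real (S (pos r - 1))" for r
    proof -
      have "?h i n = real (S i)" if "i \<le> m" for i
        using feas that by (auto simp: feasible_def boundary_def)
      then show ?thesis using full_row[of r] pr[of r] by simp
    qed
    ultimately show ?sign unfolding sign_matrix_def by blast
  qed
qed

text \<open>This is S_i, with x \<ge> \<lambda>_1 - i + 1 written without truncated
  subtraction.\<close>

definition parts_above :: "nat list \<Rightarrow> nat \<Rightarrow> nat" where
  "parts_above lam i = length (filter (\<lambda>x. nth_part lam 1 < x + i) lam)"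

text \<open>An upward closed property selects an initial segment of a decreasing list.\<close>

lemma le_length_filter_sorted:
  assumes "sorted_wrt (\<ge>) xs" and "\<And>x y. P x \<Longrightarrow> x \<le> y \<Longrightarrow> P y" and "1 \<le> t"
  shows "t \<le> length (filter P xs) \<longleftrightarrow> t \<le> length xs \<and> P (xs ! (t - 1))"
  using assms(1,3)
proof (induction xs arbitrary: t)
  case (Cons x xs)
  show ?case
  proof (cases "P x")
    case True
    show ?thesis
    proof (cases "t = 1")
      case False
      then have "t \<le> length (filter P (x # xs)) \<longleftrightarrow> t - 1 \<le> length (filter P xs)"
        using True Cons.prems by auto
      also have "\<dots> \<longleftrightarrow> t - 1 \<le> length xs \<and> P (xs ! (t - 1 - 1))"
        using Cons False by auto
      also have "\<dots> \<longleftrightarrow> t \<le> length (x # xs) \<and> P ((x # xs) ! (t - 1))"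
        using Cons.prems False by (auto simp: nth_Cons')
      finally show ?thesis .
    qed (use True in simp)
  next
    case False
    then have no: "\<not> P y" if "y \<in> set (x # xs)" for y
      using that Cons.prems(1) assms(2)[of y x] by auto
    then have "filter P (x # xs) = []" by (simp add: filter_empty_conv)
    moreover have "\<not> P ((x # xs) ! (t - 1))" if "t \<le> length (x # xs)"
      using that Cons.prems(2) by (intro no nth_mem) auto
    ultimately show ?thesis using Cons.prems by auto
  qed
qed simp

context
  fixes lam :: "nat list"
  assumes part: "is_partition lam" and nonempty: "1 \<le> length lam"
begin

lemma nth_part_1: "nth_part lam 1 = hd lam"
  using nonempty by (cases lam) (auto simp: nth_part_def)

lemma part_le: "x \<in> set lam \<Longrightarrow> x \<le> nth_part lam 1"
  unfolding nth_part_1 using part by (cases lam) (auto simp: is_partition_def)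

lemma nth_part_le: "nth_part lam t \<le> nth_part lam 1"
  using part_le nonempty by (auto simp: nth_part_def)

lemma part_pos: "x \<in> set lam \<Longrightarrow> 0 < x"
  using part by (cases "x = 0") (auto simp: is_partition_def)

lemma nth_part_1_mem: "nth_part lam 1 \<in> set lam"
  unfolding nth_part_1 using nonempty by (cases lam) auto

text \<open>Conjugation of the partition: it turns counts of rows into parts. For \<open>t\<close>
  beyond the length, \<open>nth_part\<close> is 0 and the right side fails because
  \<open>i \<le> nth_part lam 1\<close>.\<close>

lemma le_parts_above_iff:
  assumes "1 \<le> t" "i \<le> nth_part lam 1"
  shows "t \<le> parts_above lam i \<longleftrightarrow> nth_part lam 1 < nth_part lam t + i"
  unfolding parts_above_def
  by (subst le_length_filter_sorted)
    (use part assms in \<open>auto simp: is_partition_def nth_part_def split: if_splits\<close>)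

lemma parts_above_0: "parts_above lam 0 = 0"
  using part_le by (auto simp: parts_above_def filter_empty_conv not_less)

lemma parts_above_top: "parts_above lam (nth_part lam 1) = length lam"
  unfolding parts_above_def using part_pos by (subst filter_True) auto

lemma parts_above_step:
  assumes "1 \<le> i" "i \<le> nth_part lam 1"
  shows "parts_above lam i = parts_above lam (i - 1) + part_count lam (nth_part lam 1 - i + 1)"
proof -
  define M where "M = nth_part lam 1"
  have "length (filter (\<lambda>x. M < x + i) xs) = length (filter (\<lambda>x. M < x + (i - 1)) xs) + count_list xs (M - i + 1)" for xs
    using assms by (induction xs) (auto simp: M_def)
  then show ?thesis by (simp add: parts_above_def part_count_def M_def)
qed

lemma parts_above_1: "parts_above lam 1 = part_count lam (nth_part lam 1)"
  using parts_above_step[of 1] parts_above_0 part_pos[OF nth_part_1_mem] by simp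

lemma row_sums_parts_above:
  assumes "length lam \<le> n - 1" "2 \<le> n"
  shows "row_sums (nth_part lam 1) n (parts_above lam)"
proof
  show 1: "1 \<le> nth_part lam 1" using part_pos[OF nth_part_1_mem] by simp
  show "1 \<le> parts_above lam 1" using 1 by (simp add: le_parts_above_iff)
  show "parts_above lam i \<le> parts_above lam (Suc i)" if "i < nth_part lam 1" for i
    using parts_above_step[of "Suc i"] that by simp
qed (use assms parts_above_0 parts_above_top in auto)

lemma card_le_parts_above:
  assumes "1 \<le> t"
  shows "card {i \<in> {1..nth_part lam 1}. t \<le> parts_above lam i} = nth_part lam t"
proof -
  have "{i \<in> {1..nth_part lam 1}. t \<le> parts_above lam i} = {nth_part lam 1 + 1 - nth_part lam t..nth_part lam 1}"
    using le_parts_above_iff[OF assms] nth_part_le[of t] by auto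
  then show ?thesis using nth_part_le[of t] by simp
qed

lemma card_parts_above_less:
  assumes "1 \<le> t"
  shows "int (card {i \<in> {1..nth_part lam 1}. parts_above lam i < t}) = int (nth_part lam 1) - int (nth_part lam t)"
proof -
  have "{1..nth_part lam 1} = {i \<in> {1..nth_part lam 1}. parts_above lam i < t} \<union> {i \<in> {1..nth_part lam 1}. t \<le> parts_above lam i}"
    by auto
  then have "card {1..nth_part lam 1} = card {i \<in> {1..nth_part lam 1}. parts_above lam i < t} + card {i \<in> {1..nth_part lam 1}. t \<le> parts_above lam i}"
    by (metis (no_types, lifting) card_Un_disjoint disjoint_iff finite_Un finite_atLeastAtMost mem_Collect_eq not_le)
  then show ?thesis using card_le_parts_above[OF assms] by simp
qed

text \<open>The increase of S at row i is the multiplicity of \<lambda>_1 - i + 1, so it is positive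
  exactly at part sizes; this reflection is its own inverse.\<close>

lemma card_jumps_parts_above:
  "card {i \<in> {1..nth_part lam 1}. parts_above lam (i - 1) < parts_above lam i} = distinct_parts lam"
  unfolding distinct_parts_def
proof (rule bij_betw_same_card)
  have jump: "parts_above lam (i - 1) < parts_above lam i \<longleftrightarrow> nth_part lam 1 - i + 1 \<in> set lam"
    if "1 \<le> i" "i \<le> nth_part lam 1" for i
    using parts_above_step[OF that] by (simp add: part_count_def count_list_0_iff flip: neq0_conv)
  show "bij_betw (\<lambda>i. nth_part lam 1 - i + 1)
     {i \<in> {1..nth_part lam 1}. parts_above lam (i - 1) < parts_above lam i} (set lam)"
  proof (rule bij_betw_byWitness[where f' = "\<lambda>x. nth_part lam 1 - x + 1"])
    show "(\<lambda>x. nth_part lam 1 - x + 1) ` set lam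
      \<subseteq> {i \<in> {1..nth_part lam 1}. parts_above lam (i - 1) < parts_above lam i}"
    proof
      fix i assume "i \<in> (\<lambda>x. nth_part lam 1 - x + 1) ` set lam"
      then obtain x where x: "x \<in> set lam" "i = nth_part lam 1 - x + 1" by auto
      moreover from x have "1 \<le> i" "i \<le> nth_part lam 1" "nth_part lam 1 - i + 1 = x"
        using part_pos[OF x(1)] part_le[OF x(1)] by auto
      ultimately show "i \<in> {i \<in> {1..nth_part lam 1}. parts_above lam (i - 1) < parts_above lam i}"
        using jump[of i] by simp
    qed
  qed (use jump part_pos part_le in fastforce)+
qed

text \<open>C(\<lambda>) gathers the indicator terms of the count, which come from columns 1 and n.
  The translation uses that S_1 is the multiplicity of \<lambda>_1: it is at least 2 iff \<lambda>_1
  = \<lambda>_2, and equals k iff all parts agree.\<close>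

lemma facet_corr_parts_above:
  assumes "length lam \<le> n - 1" "2 \<le> n"
  shows "facet_corr lam n = 2 - of_bool (parts_above lam 1 < n - 1 \<or> n = 2) - of_bool (1 < length lam \<or> n = 2)
    + of_bool (length lam = n - 1) + of_bool (parts_above lam 1 = 1)"
proof -
  have pos: "1 \<le> nth_part lam 1" using part_pos[OF nth_part_1_mem] by simp
  have one: "1 \<le> parts_above lam 1" using pos by (simp add: le_parts_above_iff)
  have two: "2 \<le> parts_above lam 1 \<longleftrightarrow> nth_part lam 1 = nth_part lam 2"
    using le_parts_above_iff[of 2 1] pos nth_part_le[of 2] by auto
  have le: "parts_above lam 1 \<le> length lam" by (simp add: parts_above_def)
  have full: "parts_above lam 1 = length lam \<longleftrightarrow> (\<forall>x\<in>set lam. x = nth_part lam 1)"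
  proof -
    have "parts_above lam 1 = length lam \<longleftrightarrow> (\<forall>x\<in>set lam. nth_part lam 1 < x + 1)"
      unfolding parts_above_def by (metis (mono_tags, lifting) filter_True length_filter_less less_irrefl)
    also have "\<dots> \<longleftrightarrow> (\<forall>x\<in>set lam. x = nth_part lam 1)"
      using part_le by (metis Suc_eq_plus1 le_antisym lessI less_Suc_eq_le)
    finally show ?thesis .
  qed
  show ?thesis
    unfolding facet_corr_def full[symmetric] two[symmetric]
    using one le nonempty assms by auto
qed

end

theorem theorem6p2:
  fixes lam :: "nat list" and n :: nat
  assumes "n \<ge> 2"
    and "is_partition lam"
    and "1 \<le> length lam" and "length lam \<le> n - 1"
    and "CARD('r::{finite,linorder}) = nth_part lam 1"
    and "CARD('c::{finite,linorder}) = n"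
  shows "int (card {F. F facet_of (sign_polytope lam :: (real^'c::{finite,linorder}^'r::{finite,linorder}) set)}) =
           3 * int n * int (nth_part lam 1) - int n - 3 * (int (nth_part lam 1) - 1)
           - (int n - 2) * (int (nth_part lam 1) - int (nth_part lam 2) + int (nth_part lam (n - 1)))
           - (int (length lam) - int (part_count lam (nth_part lam 1)))
           - 2 * (int (nth_part lam 1) - int (distinct_parts lam))
           - facet_corr lam n"
proof -
  let ?m = "nth_part lam 1" and ?S = "parts_above lam"
  note lam = assms(2,3)
  note rs = row_sums_parts_above[OF lam assms(4,1)]
  interpret row_sums ?m n ?S by (rule rs)
  have step: "real (part_count lam (?m - pos r + 1)) = real (?S (pos r)) - real (?S (pos r - 1))" for r :: 'r
    using parts_above_step[OF lam, of "pos r"] pos_ge_1[of r] pos_le_card[of r] assms(5) by simp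
  have "(sign_matrices lam :: ('r, 'c) real_matrix set) =
    {A. feasible (corner_sum A) \<and> (\<forall>i\<le>?m. \<forall>j\<le>n. corner_sum A i j \<in> \<int>)}"
    unfolding sign_matrices_def step
    using sign_matrix_feasible_iff[OF rs assms(5,6)] by simp
  then have "(sign_polytope lam :: ('r, 'c) real_matrix set) = {A. feasible (corner_sum A)}"
    unfolding sign_polytope_def using convex_hull_integral_feasible[OF assms(5,6)] by simp
  then have facets: "card {F. F facet_of (sign_polytope lam :: ('r, 'c) real_matrix set)} = card facet_ineqs"
    using card_facets_feasible[OF assms(5,6)] by simp
  have S1: "card {i \<in> {1..?m}. 1 < ?S i} = nth_part lam 2"
    using card_le_parts_above[OF lam, of 2] by (simp add: Suc_le_eq numeral_2_eq_2)
  have Sn: "int (card {i \<in> {1..?m}. ?S i < n - 1}) = int ?m - int (nth_part lam (n - 1))"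
    using assms(1) by (intro card_parts_above_less[OF lam]) simp
  \<comment> \<open>The indicators of the count sum to 2 - C(\<lambda>); what remains is a
    polynomial identity.\<close>
  show ?thesis
    unfolding facets card_facet_ineqs facet_corr_parts_above[OF lam assms(4,1)]
      S1 Sn card_jumps_parts_above[OF lam] parts_above_top[OF lam] parts_above_1[OF lam]
    by (simp only: algebra_simps)
qed

end
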